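(* Let $\Gamma$ be a finitely generated non-amenable group. Then the expected degree of the free minimal spanning forest depends on the generating multi-set, i.e. there exist finite symmetric generating multi-sets $S,S'$ of $\Gamma$ with $\delta_{\rm FMSF}(\Gamma,S)\ne\delta_{\rm FMSF}(\Gamma,S')$. Moreover, for every $n\in\mathbb N$ there exists a finite symmetric multi-set $S$ which generates $\Gamma$ such that $\delta_{\rm FMSF}(\Gamma,S)\ge n$.
   Context: Graphs. A graph $G=(V,E^\sharp)$ consists of a vertex set $V$ and a set $E^\sharp$ of oriented edges; each $e\in E^\sharp$ has a tail $\underline e$, a head $\overline e$, and an opposite oriented edge $\hat e\in E^\sharp$, with $e\neq\hat e$. Loops and multiple edges are allowed. An (unoriented) edge is a pair $\{e,\hat e\}$, and $E$ is the set of edges. A cycle of length $n$ is a sequence $(e_1,\dots,e_n)$ of oriented edges with $\overline{e_i}=\underline{e_{i+1}}$ for $1\le i<n$ and $\overline{e_n}=\underline{e_1}$. It is simple if no vertex is visited twice (apart from the return to the start at the end) and it is not of the form $(e,\hat e)$; in particular a loop is a simple cycle of length $1$. Generating multi-sets and Cayley graphs. A finite symmetric multi-set in $\Gamma$ is a finite set $S$ with a map $\alpha:S\to\Gamma$ and an involution $\iota:S\to S$ such that $\alpha(\iota(s))=\alpha(s)^{-1}$ for all $s\in S$; it generates $\Gamma$ if $\alpha(S)$ does. One writes $s$ for $\alpha(s)$ and $s^{-1}$ for $\iota(s)$. The Cayley graph $\mathrm{Cay}(\Gamma,S)$ has vertex set $\Gamma$ and, for every $g\in\Gamma$, $s\in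 S$, an oriented edge $(g,s,sg)$ from $g$ to $sg$, whose opposite edge is $(sg,s^{-1},g)$. The requirement $e\ne\hat e$ means that $\iota(s)\ne s$ whenever $\alpha(s)$ is the identity. Free minimal spanning forest. For a graph $G$, spanning subgraphs are identified with elements of $\{0,1\}^E$. Define $\Phi:[0,1]^E\to\{0,1\}^E$: given a labelling $x\in[0,1]^E$, an edge is removed if and only if it belongs to some simple cycle of $G$ in which its label is maximal among the labels of the edges of that cycle; $\Phi(x)$ is the spanning subgraph formed by the remaining edges. $\mathrm{FMSF}:=\Phi_*(\mu^{\otimes E})$, where $\mu$ is Lebesgue measure on $[0,1]$. For $G=\mathrm{Cay}(\Gamma,S)$, $\delta_{\rm FMSF}(\Gamma,S)$ denotes the expected degree, with respect to $\mathrm{FMSF}$, of a fixed vertex (independent of the choice of vertex). *)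

theory Defs
  imports
    "HOL-Algebra.Algebra"
    "HOL-Probability.Probability"
    "Graph_Theory.Graph_Theory"
begin

section \<open>Groups\<close>

definition finitely_generated :: "('a, 'm) monoid_scheme \<Rightarrow> bool" where
  "finitely_generated \<Gamma> \<longleftrightarrow>
    (\<exists>A. finite A \<and> A \<subseteq> carrier \<Gamma> \<and> generate \<Gamma> A = carrier \<Gamma>)"

text \<open>Amenability of a discrete group in the sense of von Neumann: there is a finitely additive,
  left-invariant probability measure defined on all subsets of the group.\<close>

definition amenable :: "('a, 'm) monoid_scheme \<Rightarrow> bool" where
  "amenable \<Gamma> \<longleftrightarrow>
    (\<exists>m :: 'a set \<Rightarrow> real.
      (\<forall>A \<subseteq> carrier \<Gamma>. 0 \<le> m A) \<and>
      m (carrier \<Gamma>) = 1 \<and>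
      additive (Pow (carrier \<Gamma>)) m \<and>
      (\<forall>g \<in> carrier \<Gamma>. \<forall>A \<subseteq> carrier \<Gamma>. m (g <#\<^bsub>\<Gamma>\<^esub> A) = m A))"

section \<open>Free minimal spanning forest\<close>

text \<open>A graph whose oriented edges come with opposites is represented by a digraph \<open>G\<close> together
  with a reversal \<open>arev\<close> of its arcs, as in \<^locale>\<open>bidirected_digraph\<close>, which includes the
  requirement \<open>arev a \<noteq> a\<close> for all arcs. Outside the set of arcs \<open>arev\<close> is the identity.\<close>

definition edges :: "('v, 'e) pre_digraph \<Rightarrow> ('e \<Rightarrow> 'e) \<Rightarrow> 'e set set" where
  "edges G arev = {{a, arev a} | a. a \<in> arcs G}"

text \<open>\<^const>\<open>pre_digraph.cycle\<close> asks for a nonempty closed walk without repeated vertices. It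
  admits loops as well as back-and-forth walks along a single edge; the latter are excluded.\<close>

definition simple_cycle :: "('v, 'e) pre_digraph \<Rightarrow> ('e \<Rightarrow> 'e) \<Rightarrow> 'e list \<Rightarrow> bool" where
  "simple_cycle G arev p \<longleftrightarrow> pre_digraph.cycle G p \<and> (\<nexists>a. p = [a, arev a])"

definition cycle_edges :: "('e \<Rightarrow> 'e) \<Rightarrow> 'e list \<Rightarrow> 'e set set" where
  "cycle_edges arev p = (\<lambda>a. {a, arev a}) ` set p"

text \<open>Spanning subgraphs are elements of \<open>{0, 1}\<^sup>E\<close>, with \<open>bool\<close> in the role of \<open>{0, 1}\<close>.\<close>

definition fmsf_map ::
    "('v, 'e) pre_digraph \<Rightarrow> ('e \<Rightarrow> 'e) \<Rightarrow> ('e set \<Rightarrow> real) \<Rightarrow> ('e set \<Rightarrow> bool)" where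
  "fmsf_map G arev x = (\<lambda>e \<in> edges G arev.
    \<not> (\<exists>p. simple_cycle G arev p \<and> e \<in> cycle_edges arev p \<and>
          (\<forall>f \<in> cycle_edges arev p. x f \<le> x e)))"

definition label_space :: "('v, 'e) pre_digraph \<Rightarrow> ('e \<Rightarrow> 'e) \<Rightarrow> ('e set \<Rightarrow> real) measure" where
  "label_space G arev = PiM (edges G arev) (\<lambda>_. restrict_space lborel {0..1})"

definition subgraph_space :: "('v, 'e) pre_digraph \<Rightarrow> ('e \<Rightarrow> 'e) \<Rightarrow> ('e set \<Rightarrow> bool) measure" where
  "subgraph_space G arev = PiM (edges G arev) (\<lambda>_. count_space UNIV)"

definition FMSF :: "('v, 'e) pre_digraph \<Rightarrow> ('e \<Rightarrow> 'e) \<Rightarrow> ('e set \<Rightarrow> bool) measure" where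
  "FMSF G arev = distr (label_space G arev) (subgraph_space G arev) (fmsf_map G arev)"

definition spanning_subgraph ::
    "('v, 'e) pre_digraph \<Rightarrow> ('e \<Rightarrow> 'e) \<Rightarrow> ('e set \<Rightarrow> bool) \<Rightarrow> ('v, 'e) pre_digraph" where
  "spanning_subgraph G arev \<omega> = G\<lparr>arcs := {a \<in> arcs G. \<omega> {a, arev a}}\<rparr>"

text \<open>The degree of a vertex is the number of oriented edges with that vertex as tail.\<close>

definition expected_degree :: "('v, 'e) pre_digraph \<Rightarrow> ('e \<Rightarrow> 'e) \<Rightarrow> 'v \<Rightarrow> real" where
  "expected_degree G arev v =
    (\<integral>\<omega>. real (out_degree (spanning_subgraph G arev \<omega>) v) \<partial>FMSF G arev)"

section \<open>Cayley graphs\<close>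

text \<open>The last conjunct says precisely that no oriented edge of the Cayley graph is its own
  opposite, cf. \<open>bidirected_cayley\<close> below.\<close>

definition symmetric_multiset ::
    "('a, 'm) monoid_scheme \<Rightarrow> 's set \<Rightarrow> ('s \<Rightarrow> 'a) \<Rightarrow> ('s \<Rightarrow> 's) \<Rightarrow> bool" where
  "symmetric_multiset \<Gamma> S \<alpha> \<iota> \<longleftrightarrow>
    finite S \<and> \<alpha> \<in> S \<rightarrow> carrier \<Gamma> \<and> \<iota> \<in> S \<rightarrow> S \<and>
    (\<forall>s \<in> S. \<iota> (\<iota> s) = s) \<and>
    (\<forall>s \<in> S. \<alpha> (\<iota> s) = inv\<^bsub>\<Gamma>\<^esub> (\<alpha> s)) \<and>
    (\<forall>s \<in> S. \<alpha> s = \<one>\<^bsub>\<Gamma>\<^esub> \<longrightarrow> \<iota> s \<noteq> s)"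

definition generating_multiset ::
    "('a, 'm) monoid_scheme \<Rightarrow> 's set \<Rightarrow> ('s \<Rightarrow> 'a) \<Rightarrow> ('s \<Rightarrow> 's) \<Rightarrow> bool" where
  "generating_multiset \<Gamma> S \<alpha> \<iota> \<longleftrightarrow>
    symmetric_multiset \<Gamma> S \<alpha> \<iota> \<and> generate \<Gamma> (\<alpha> ` S) = carrier \<Gamma>"

definition cayley ::
    "('a, 'm) monoid_scheme \<Rightarrow> 's set \<Rightarrow> ('s \<Rightarrow> 'a) \<Rightarrow> ('a, 'a \<times> 's \<times> 'a) pre_digraph" where
  "cayley \<Gamma> S \<alpha> =
    \<lparr>verts = carrier \<Gamma>,
     arcs = {(g, s, \<alpha> s \<otimes>\<^bsub>\<Gamma>\<^esub> g) | g s. g \<in> carrier \<Gamma> \<and> s \<in> S},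
     tail = (\<lambda>(g, s, h). g),
     head = (\<lambda>(g, s, h). h)\<rparr>"

definition cayley_rev ::
    "('a, 'm) monoid_scheme \<Rightarrow> 's set \<Rightarrow> ('s \<Rightarrow> 'a) \<Rightarrow> ('s \<Rightarrow> 's) \<Rightarrow>
      'a \<times> 's \<times> 'a \<Rightarrow> 'a \<times> 's \<times> 'a" where
  "cayley_rev \<Gamma> S \<alpha> \<iota> = (\<lambda>(g, s, h).
    if (g, s, h) \<in> arcs (cayley \<Gamma> S \<alpha>) then (h, \<iota> s, g) else (g, s, h))"

lemma bidirected_cayley:
  assumes "group \<Gamma>" and S: "symmetric_multiset \<Gamma> S \<alpha> \<iota>"
  shows "bidirected_digraph (cayley \<Gamma> S \<alpha>) (cayley_rev \<Gamma> S \<alpha> \<iota>)"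
proof -
  interpret group \<Gamma> by fact
  let ?G = "cayley \<Gamma> S \<alpha>"
  have \<alpha>: "\<alpha> s \<in> carrier \<Gamma>" and \<iota>: "\<iota> s \<in> S" "\<iota> (\<iota> s) = s" "\<alpha> (\<iota> s) = inv\<^bsub>\<Gamma>\<^esub> (\<alpha> s)"
    and one: "\<alpha> s = \<one>\<^bsub>\<Gamma>\<^esub> \<Longrightarrow> \<iota> s \<noteq> s" if "s \<in> S" for s
    using S that unfolding symmetric_multiset_def by auto
  interpret wf_digraph ?G
    by unfold_locales (auto simp: cayley_def \<alpha>)
  have rev: "(\<alpha> s \<otimes>\<^bsub>\<Gamma>\<^esub> g, \<iota> s, g) \<in> arcs ?G" if "g \<in> carrier \<Gamma>" "s \<in> S" for g s
  proof -
    have "g = \<alpha> (\<iota> s) \<otimes>\<^bsub>\<Gamma>\<^esub> (\<alpha> s \<otimes>\<^bsub>\<Gamma>\<^esub> g)"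
      using that \<alpha>[of s] \<iota>[of s] by (metis inv_closed l_inv l_one m_assoc)
    moreover have "\<alpha> s \<otimes>\<^bsub>\<Gamma>\<^esub> g \<in> carrier \<Gamma>" "\<iota> s \<in> S"
      using that \<alpha> \<iota> by auto
    ultimately show ?thesis
      unfolding cayley_def by simp
  qed
  have arcE: "\<exists>g s. a = (g, s, \<alpha> s \<otimes>\<^bsub>\<Gamma>\<^esub> g) \<and> g \<in> carrier \<Gamma> \<and> s \<in> S" if "a \<in> arcs ?G" for a
    using that by (auto simp: cayley_def)
  have rev_eq: "cayley_rev \<Gamma> S \<alpha> \<iota> (g, s, h) = (h, \<iota> s, g)" if "(g, s, h) \<in> arcs ?G" for g s h
    using that by (simp add: cayley_rev_def)
  show ?thesis
  proof (rule bidirected_digraphI)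
    fix a assume "a \<notin> arcs ?G"
    then show "cayley_rev \<Gamma> S \<alpha> \<iota> a = a"
      by (auto simp: cayley_rev_def split: prod.splits)
  next
    fix a assume a: "a \<in> arcs ?G"
    then obtain g s where gs: "a = (g, s, \<alpha> s \<otimes>\<^bsub>\<Gamma>\<^esub> g)" "g \<in> carrier \<Gamma>" "s \<in> S"
      using arcE by blast
    show "cayley_rev \<Gamma> S \<alpha> \<iota> a \<noteq> a"
    proof
      assume "cayley_rev \<Gamma> S \<alpha> \<iota> a = a"
      with a gs have "\<alpha> s \<otimes>\<^bsub>\<Gamma>\<^esub> g = g" "\<iota> s = s"
        by (auto simp: rev_eq)
      moreover from this(1) have "\<alpha> s = \<one>\<^bsub>\<Gamma>\<^esub>"
        using gs \<alpha>[of s] right_cancel[of g "\<alpha> s" "\<one>\<^bsub>\<Gamma>\<^esub>"] by simp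
      ultimately show False
        using gs one by blast
    qed
    show "cayley_rev \<Gamma> S \<alpha> \<iota> (cayley_rev \<Gamma> S \<alpha> \<iota> a) = a"
      using a gs rev \<iota> by (simp add: rev_eq)
    show "tail ?G (cayley_rev \<Gamma> S \<alpha> \<iota> a) = head ?G a"
      using a gs by (simp add: rev_eq) (simp add: cayley_def)
  qed
qed

text \<open>Right translations act transitively on the vertices by automorphisms of the Cayley graph,
  so the identity may serve as the fixed vertex.\<close>

definition delta_FMSF ::
    "('a, 'm) monoid_scheme \<Rightarrow> 's set \<Rightarrow> ('s \<Rightarrow> 'a) \<Rightarrow> ('s \<Rightarrow> 's) \<Rightarrow> real" where
  "delta_FMSF \<Gamma> S \<alpha> \<iota> =
    expected_degree (cayley \<Gamma> S \<alpha>) (cayley_rev \<Gamma> S \<alpha> \<iota>) \<one>\<^bsub>\<Gamma>\<^esub>"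

end

theory Submission
  imports Defs
begin

text \<open>Let \<open>A\<close> be a finite symmetric generating set containing the identity. If the operator on
  \<open>\<ell>\<^sup>2(\<Gamma>)\<close> that sums over the \<open>A\<close>-neighbours had norm \<open>|A|\<close>, there would be almost invariant vectors
  \<open>f\<close>, and the probability measures proportional to \<open>f\<^sup>2\<close> would accumulate at an invariant mean. Hence
  for non-amenable \<open>\<Gamma>\<close> the norm is some \<open>R < |A|\<close>, and passing to the multi-set of words of length \<open>k\<close>
  makes the ratio \<open>|A|\<^sup>k / R\<^sup>k\<close> of degree to norm arbitrarily large. If a Cayley graph has degree \<open>d\<close> and
  operator norm at most \<open>R\<close>, it has at most \<open>R\<^sup>n\<close> closed walks of length \<open>n\<close> at a vertex, and a union
  bound over these shows that the expected degree of its free minimal spanning forest is at least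
  \<open>d / (2 * R) - 1\<close>.\<close>

section \<open>Norms of walk operators\<close>

lemma sum_list_product:
  "(\<Sum>z\<leftarrow>List.product xs ys. h z) = (\<Sum>x\<leftarrow>xs. \<Sum>y\<leftarrow>ys. h (x, y))"
  for h :: "'x \<times> 'y \<Rightarrow> real"
  by (induction xs) (simp_all add: o_def)

lemma sum_list_swap:
  "(\<Sum>x\<leftarrow>xs. \<Sum>y\<leftarrow>ys. h x y) = (\<Sum>y\<leftarrow>ys. \<Sum>x\<leftarrow>xs. h x y)" for h :: "'x \<Rightarrow> 'y \<Rightarrow> real"
  by (induction xs) (simp_all add: sum_list_addf)

text \<open>Tychonoff's theorem: the set is a product of intervals, and functions carry the topology
  of pointwise convergence. An exactly invariant mean is later obtained inside this cube as a limit
  of almost invariant ones.\<close>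

lemma compact_unit_cube: "compact {m :: 'x \<Rightarrow> real. \<forall>i. 0 \<le> m i \<and> m i \<le> 1}"
proof -
  have "compactin (product_topology (\<lambda>_. euclideanreal) UNIV) (PiE (UNIV :: 'x set) (\<lambda>_. {0..1}))"
    by (simp add: compactin_PiE)
  moreover have "PiE (UNIV :: 'x set) (\<lambda>_. {0..1::real}) = {m. \<forall>i. 0 \<le> m i \<and> m i \<le> 1}"
    by (auto simp: PiE_iff)
  ultimately show ?thesis
    by (simp add: euclidean_product_topology)
qed

context group
begin

section \<open>Finitely supported functions on the group and operators on them\<close>

definition fin_supp :: "('a \<Rightarrow> real) \<Rightarrow> bool" where
  "fin_supp f \<longleftrightarrow> finite {g \<in> carrier G. f g \<noteq> 0}"

text \<open>The squared norm of \<open>l^2\<close> on its dense subspace of finitely supported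
  functions, where only finite sums occur. For an infinite support the sum takes the default value
  \<open>0\<close>, hence the hypotheses \<open>fin_supp\<close> below. Values off the carrier are
  ignored throughout.\<close>

definition sqnorm :: "('a \<Rightarrow> real) \<Rightarrow> real" where
  "sqnorm f = (\<Sum>g | g \<in> carrier G \<and> f g \<noteq> 0. (f g)\<^sup>2)"

text \<open>The adjacency operator of the Cayley graph with edges from \<open>g\<close> to
  \<open>x \<otimes> g\<close>. A list instead of a set records multiplicities.\<close>

definition walk_op :: "'a list \<Rightarrow> ('a \<Rightarrow> real) \<Rightarrow> 'a \<Rightarrow> real" where
  "walk_op xs f g = (\<Sum>x\<leftarrow>xs. f (x \<otimes> g))"

text \<open>The operator norm on \<open>l^2\<close> is at most the absolute value of
  \<open>R\<close>, tested on a dense subspace and squared to avoid roots.\<close>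

definition norm_bound :: "'a list \<Rightarrow> real \<Rightarrow> bool" where
  "norm_bound xs R \<longleftrightarrow> (\<forall>f. fin_supp f \<longrightarrow> sqnorm (walk_op xs f) \<le> R\<^sup>2 * sqnorm f)"

lemma sqnorm_eq:
  assumes "finite F" "F \<subseteq> carrier G" "\<And>g. g \<in> carrier G \<Longrightarrow> f g \<noteq> 0 \<Longrightarrow> g \<in> F"
  shows "sqnorm f = (\<Sum>g\<in>F. (f g)\<^sup>2)"
  unfolding sqnorm_def using assms by (intro sum.mono_neutral_left) auto

lemma sqnorm_cong:
  assumes "\<And>g. g \<in> carrier G \<Longrightarrow> f g = f' g"
  shows "sqnorm f = sqnorm f'"
  unfolding sqnorm_def using assms by (intro sum.cong) auto

lemma sqnorm_nonneg [simp]: "0 \<le> sqnorm f"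
  unfolding sqnorm_def by (intro sum_nonneg) simp

lemma square_le_sqnorm:
  assumes "fin_supp f" "g \<in> carrier G"
  shows "(f g)\<^sup>2 \<le> sqnorm f"
proof (cases "f g = 0")
  case False
  then show ?thesis
    using assms unfolding sqnorm_def fin_supp_def by (intro member_le_sum) auto
qed simp

lemma inv_mult_cancel_left [simp]:
  assumes "a \<in> carrier G" "g \<in> carrier G"
  shows "inv a \<otimes> (a \<otimes> g) = g" "a \<otimes> (inv a \<otimes> g) = g"
  using assms m_assoc[of "inv a" a g] m_assoc[of a "inv a" g] by simp_all

lemma fin_supp_translate:
  assumes "fin_supp f" "a \<in> carrier G"
  shows "fin_supp (\<lambda>g. f (a \<otimes> g))"
proof -
  have "{g \<in> carrier G. f (a \<otimes> g) \<noteq> 0} \<subseteq> (\<lambda>h. inv a \<otimes> h) ` {h \<in> carrier G. f h \<noteq> 0}"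
  proof
    fix g assume g: "g \<in> {g \<in> carrier G. f (a \<otimes> g) \<noteq> 0}"
    then have "g = inv a \<otimes> (a \<otimes> g)"
      using assms by simp
    then show "g \<in> (\<lambda>h. inv a \<otimes> h) ` {h \<in> carrier G. f h \<noteq> 0}"
      using g assms by blast
  qed
  moreover have "finite ((\<lambda>h. inv a \<otimes> h) ` {h \<in> carrier G. f h \<noteq> 0})"
    using assms(1) by (simp add: fin_supp_def)
  ultimately show ?thesis
    unfolding fin_supp_def by (rule finite_subset)
qed

lemma sqnorm_translate:
  assumes "a \<in> carrier G"
  shows "sqnorm (\<lambda>g. f (a \<otimes> g)) = sqnorm f"
  unfolding sqnorm_def using assms
  by (intro sum.reindex_bij_witness[where i = "\<lambda>h. inv a \<otimes> h" and j = "\<lambda>g. a \<otimes> g"])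
    auto

lemma fin_supp_add:
  assumes "fin_supp f" "fin_supp f'"
  shows "fin_supp (\<lambda>g. f g + f' g)"
  unfolding fin_supp_def
proof (rule finite_subset)
  show "finite ({g \<in> carrier G. f g \<noteq> 0} \<union> {g \<in> carrier G. f' g \<noteq> 0})"
    using assms unfolding fin_supp_def by (rule finite_UnI)
qed force

text \<open>The parallelogram law with the nonnegative term for \<open>f - f'\<close> dropped. It is
  sharp for \<open>f = f'\<close> and therefore gives the same constant as the triangle inequality
  in \<open>norm_bound_append\<close>.\<close>

lemma sqnorm_add_le:
  assumes "fin_supp f" "fin_supp f'"
  shows "sqnorm (\<lambda>g. f g + f' g) \<le> 2 * sqnorm f + 2 * sqnorm f'"
proof -
  let ?F = "{g \<in> carrier G. f g \<noteq> 0} \<union> {g \<in> carrier G. f' g \<noteq> 0}"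
  have F: "finite ?F" "?F \<subseteq> carrier G"
    using assms unfolding fin_supp_def by (rule finite_UnI) blast
  have "(\<Sum>g\<in>?F. (f g + f' g)\<^sup>2) \<le> (\<Sum>g\<in>?F. 2 * (f g)\<^sup>2 + 2 * (f' g)\<^sup>2)"
  proof (rule sum_mono)
    fix g
    show "(f g + f' g)\<^sup>2 \<le> 2 * (f g)\<^sup>2 + 2 * (f' g)\<^sup>2"
      using zero_le_power2[of "f g - f' g"] by (simp add: power2_sum power2_diff)
  qed
  moreover have "sqnorm f = (\<Sum>g\<in>?F. (f g)\<^sup>2)" "sqnorm f' = (\<Sum>g\<in>?F. (f' g)\<^sup>2)"
    "sqnorm (\<lambda>g. f g + f' g) = (\<Sum>g\<in>?F. (f g + f' g)\<^sup>2)"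
    by (rule sqnorm_eq[OF F], force)+
  ultimately show ?thesis
    by (simp only: sum.distrib sum_distrib_left)
qed

lemma fin_supp_walk_op:
  assumes "fin_supp f" "set xs \<subseteq> carrier G"
  shows "fin_supp (walk_op xs f)"
  using assms(2)
proof (induction xs)
  case Nil
  then show ?case by (simp add: fin_supp_def walk_op_def)
next
  case (Cons x xs)
  then show ?case
    using fin_supp_add[OF fin_supp_translate[OF assms(1), of x]]
    by (simp add: walk_op_def)
qed

section \<open>Products and sums of multi-sets\<close>

definition list_mult :: "'a list \<Rightarrow> 'a list \<Rightarrow> 'a list" where
  "list_mult xs ys = map (\<lambda>(x, y). x \<otimes> y) (List.product xs ys)"

lemma length_list_mult: "length (list_mult xs ys) = length xs * length ys"
  by (simp add: list_mult_def)

lemma set_list_mult: "set (list_mult xs ys) = {x \<otimes> y | x y. x \<in> set xs \<and> y \<in> set ys}"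
  by (auto simp: list_mult_def)

text \<open>The list \<open>list_mult xs ys\<close> is the product of two formal sums in the group
  ring. Left translations act contravariantly on functions, so the operator of the first factor is
  applied first.\<close>

lemma walk_op_list_mult:
  assumes "set xs \<subseteq> carrier G" "set ys \<subseteq> carrier G" "g \<in> carrier G"
  shows "walk_op (list_mult xs ys) f g = walk_op ys (walk_op xs f) g"
proof -
  have "walk_op (list_mult xs ys) f g = (\<Sum>x\<leftarrow>xs. \<Sum>y\<leftarrow>ys. f ((x \<otimes> y) \<otimes> g))"
    by (subst sum_list_product[where h = "\<lambda>(x, y). f ((x \<otimes> y) \<otimes> g)", simplified, symmetric])
      (simp add: walk_op_def list_mult_def o_def split_def)
  also have "\<dots> = (\<Sum>x\<leftarrow>xs. \<Sum>y\<leftarrow>ys. f (x \<otimes> (y \<otimes> g)))"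
    using assms by (intro arg_cong[of _ _ sum_list] map_cong refl) (auto simp: m_assoc subset_iff)
  also have "\<dots> = walk_op ys (walk_op xs f) g"
    by (subst sum_list_swap) (simp add: walk_op_def)
  finally show ?thesis .
qed

text \<open>Inversion reverses products, hence the opposite order of composition. Lists of inverses
  are followed separately because the final multi-set is a list of words together with the inverses
  of these words.\<close>

lemma walk_op_inv_list_mult:
  assumes "set xs \<subseteq> carrier G" "set ys \<subseteq> carrier G" "g \<in> carrier G"
  shows "walk_op (map (m_inv G) (list_mult xs ys)) f g =
    walk_op (map (m_inv G) xs) (walk_op (map (m_inv G) ys) f) g"
proof -
  have "walk_op (map (m_inv G) (list_mult xs ys)) f g = (\<Sum>x\<leftarrow>xs. \<Sum>y\<leftarrow>ys. f (inv (x \<otimes> y) \<otimes> g))"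
    by (subst sum_list_product[where h = "\<lambda>(x, y). f (inv (x \<otimes> y) \<otimes> g)", simplified, symmetric])
      (simp add: walk_op_def list_mult_def o_def split_def)
  also have "\<dots> = (\<Sum>x\<leftarrow>xs. \<Sum>y\<leftarrow>ys. f (inv y \<otimes> (inv x \<otimes> g)))"
    using assms
    by (intro arg_cong[of _ _ sum_list] map_cong refl) (auto simp: m_assoc subset_iff inv_mult_group)
  also have "\<dots> = walk_op (map (m_inv G) xs) (walk_op (map (m_inv G) ys) f) g"
    by (simp add: walk_op_def o_def)
  finally show ?thesis .
qed

lemma norm_bound_comp:
  assumes "norm_bound xs R" "norm_bound ys R'" "set xs \<subseteq> carrier G" "fin_supp f"
  shows "sqnorm (walk_op ys (walk_op xs f)) \<le> (R * R')\<^sup>2 * sqnorm f"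
proof -
  have "sqnorm (walk_op ys (walk_op xs f)) \<le> R'\<^sup>2 * sqnorm (walk_op xs f)"
    using assms fin_supp_walk_op by (simp add: norm_bound_def)
  also have "\<dots> \<le> R'\<^sup>2 * (R\<^sup>2 * sqnorm f)"
    using assms by (intro mult_left_mono) (simp_all add: norm_bound_def)
  finally show ?thesis
    by (simp add: power_mult_distrib mult_ac)
qed

lemma norm_bound_list_mult:
  assumes "norm_bound xs R" "norm_bound ys R'" "set xs \<subseteq> carrier G" "set ys \<subseteq> carrier G"
  shows "norm_bound (list_mult xs ys) (R * R')"
  unfolding norm_bound_def
proof (intro allI impI)
  fix f assume "fin_supp f"
  then show "sqnorm (walk_op (list_mult xs ys) f) \<le> (R * R')\<^sup>2 * sqnorm f"
    using norm_bound_comp[OF assms(1,2,3)] assms(3,4)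
    by (subst sqnorm_cong[OF walk_op_list_mult])
qed

lemma norm_bound_inv_list_mult:
  assumes "norm_bound (map (m_inv G) xs) R" "norm_bound (map (m_inv G) ys) R'"
    and "set xs \<subseteq> carrier G" "set ys \<subseteq> carrier G"
  shows "norm_bound (map (m_inv G) (list_mult xs ys)) (R * R')"
  unfolding norm_bound_def
proof (intro allI impI)
  fix f assume "fin_supp f"
  moreover have "set (map (m_inv G) ys) \<subseteq> carrier G"
    using assms by auto
  ultimately show "sqnorm (walk_op (map (m_inv G) (list_mult xs ys)) f) \<le> (R * R')\<^sup>2 * sqnorm f"
    using norm_bound_comp[OF assms(2,1)] assms(3,4)
    by (subst sqnorm_cong[OF walk_op_inv_list_mult]) (auto simp: mult.commute)
qed

lemma norm_bound_append:
  assumes "norm_bound xs R" "norm_bound ys R" "set xs \<subseteq> carrier G" "set ys \<subseteq> carrier G"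
  shows "norm_bound (xs @ ys) (2 * R)"
  unfolding norm_bound_def
proof (intro allI impI)
  fix f assume f: "fin_supp f"
  have "sqnorm (walk_op (xs @ ys) f) = sqnorm (\<lambda>g. walk_op xs f g + walk_op ys f g)"
    by (intro sqnorm_cong) (simp add: walk_op_def)
  also have "\<dots> \<le> 2 * sqnorm (walk_op xs f) + 2 * sqnorm (walk_op ys f)"
    using f assms by (intro sqnorm_add_le fin_supp_walk_op)
  also have "\<dots> \<le> 2 * (R\<^sup>2 * sqnorm f) + 2 * (R\<^sup>2 * sqnorm f)"
    using f assms by (intro add_mono mult_left_mono) (simp_all add: norm_bound_def)
  also have "\<dots> = (2 * R)\<^sup>2 * sqnorm f"
    by (simp add: power_mult_distrib)
  finally show "sqnorm (walk_op (xs @ ys) f) \<le> (2 * R)\<^sup>2 * sqnorm f" .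
qed

section \<open>Counting words with trivial product\<close>

abbreviation point_mass :: "'a \<Rightarrow> real" where
  "point_mass \<equiv> (\<lambda>g. if g = \<one> then 1 else 0)"

lemma sqnorm_point_mass: "fin_supp point_mass" "sqnorm point_mass = 1"
proof -
  have "{g \<in> carrier G. point_mass g \<noteq> 0} = {\<one>}"
    by auto
  then show "fin_supp point_mass" "sqnorm point_mass = 1"
    by (simp_all add: fin_supp_def sqnorm_def)
qed

lemma fin_supp_walk_op_power:
  assumes "set xs \<subseteq> carrier G"
  shows "fin_supp ((walk_op xs ^^ n) point_mass)"
  by (induction n) (simp_all only: funpow.simps o_apply id_apply sqnorm_point_mass fin_supp_walk_op assms)

lemma sqnorm_walk_op_power_le:
  assumes "norm_bound xs R" "set xs \<subseteq> carrier G"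
  shows "sqnorm ((walk_op xs ^^ n) point_mass) \<le> (R ^ n)\<^sup>2"
proof (induction n)
  case 0
  then show ?case by (simp only: funpow.simps id_apply sqnorm_point_mass power_0 one_power2)
next
  case (Suc n)
  have "sqnorm ((walk_op xs ^^ Suc n) point_mass) \<le> R\<^sup>2 * sqnorm ((walk_op xs ^^ n) point_mass)"
    unfolding funpow.simps o_apply
    using assms(1) fin_supp_walk_op_power[OF assms(2)] unfolding norm_bound_def by blast
  also have "\<dots> \<le> R\<^sup>2 * (R ^ n)\<^sup>2"
    by (intro mult_left_mono Suc zero_le_power2)
  also have "\<dots> = (R ^ Suc n)\<^sup>2"
    by (simp only: power_Suc power_mult_distrib)
  finally show ?case .
qed

text \<open>A single value is at most the \<open>l^2\<close> norm. The iterate at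
  \<open>\<one>\<close> is the number of words of length \<open>n\<close> in \<open>xs\<close> with
  product \<open>\<one>\<close>, that is, of closed walks at a vertex.\<close>

lemma walk_op_power_le:
  assumes "norm_bound xs R" "set xs \<subseteq> carrier G" "0 \<le> R"
  shows "(walk_op xs ^^ n) point_mass \<one> \<le> R ^ n"
proof (rule power2_le_imp_le)
  show "((walk_op xs ^^ n) point_mass \<one>)\<^sup>2 \<le> (R ^ n)\<^sup>2"
    by (rule order_trans[OF square_le_sqnorm sqnorm_walk_op_power_le])
      (use assms fin_supp_walk_op_power in blast)+
  show "0 \<le> R ^ n"
    using assms(3) by (rule zero_le_power)
qed

text \<open>The identity in the list already gives one word of length \<open>1\<close> with trivial
  product.\<close>

lemma norm_bound_ge_1:
  assumes "norm_bound xs R" "set xs \<subseteq> carrier G" "\<one> \<in> set xs" "0 \<le> R"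
  shows "1 \<le> R"
proof -
  have "1 = point_mass (\<one> \<otimes> \<one>)"
    by simp
  also have "\<dots> \<le> (\<Sum>x\<leftarrow>xs. point_mass (x \<otimes> \<one>))"
    using assms(3) by (intro member_le_sum_list) auto
  also have "\<dots> = (walk_op xs ^^ 1) point_mass \<one>"
    by (simp add: walk_op_def)
  also have "\<dots> \<le> R"
    using walk_op_power_le[OF assms(1,2,4), of 1] by simp
  finally show ?thesis .
qed

text \<open>Expanding the square shows that the sum of \<open>\<parallel>f(a \<cdot>) - f(b \<cdot>)\<parallel>\<^sup>2\<close> over \<open>a, b \<in> A\<close> is
  \<open>2 |A|\<^sup>2 \<parallel>f\<parallel>\<^sup>2 - 2 \<parallel>walk_op xs f\<parallel>\<^sup>2\<close>; take \<open>b = \<one>\<close>.\<close>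

lemma almost_invariant_vector:
  assumes A: "finite A" "A \<subseteq> carrier G" "\<one> \<in> A" and xs: "set xs = A" "distinct xs"
    and nb: "\<And>R. 0 \<le> R \<Longrightarrow> R < real (card A) \<Longrightarrow> \<not> norm_bound xs R" and "0 < \<epsilon>"
  shows "\<exists>f. fin_supp f \<and> 0 < sqnorm f \<and>
    (\<forall>a\<in>A. sqnorm (\<lambda>g. f (a \<otimes> g) - f g) \<le> \<epsilon> * sqnorm f)"
proof -
  define d where "d = real (card A)"
  \<comment> \<open>With this choice \<open>2 * (d^2 - R^2) = min \<epsilon> 1\<close>, which is the
    coefficient of \<open>sqnorm f\<close> that remains at the end. The minimum keeps the radicand
    positive, as \<open>d \<ge> 1\<close>.\<close>
  define R where "R = sqrt (d\<^sup>2 - min \<epsilon> 1 / 2)"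
  have d: "1 \<le> d"
    using A by (auto simp: d_def Suc_le_eq card_gt_0_iff)
  then have d2: "1 \<le> d\<^sup>2"
    by simp
  have e: "0 < min \<epsilon> 1" "min \<epsilon> 1 \<le> 1" "min \<epsilon> 1 \<le> \<epsilon>"
    using \<open>0 < \<epsilon>\<close> by auto
  have R2: "R\<^sup>2 = d\<^sup>2 - min \<epsilon> 1 / 2"
    unfolding R_def using d2 e by (intro real_sqrt_pow2) linarith
  have R: "0 \<le> R" "R < d"
  proof -
    show "0 \<le> R"
      unfolding R_def using d2 e by (intro real_sqrt_ge_zero) linarith
    show "R < d"
      using R2 e d by (intro power2_less_imp_less[of R d]) linarith+
  qed
  have "\<not> norm_bound xs R"
    using nb R by (simp add: d_def)
  then obtain f where f: "fin_supp f" and big: "R\<^sup>2 * sqnorm f < sqnorm (walk_op xs f)"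
    unfolding norm_bound_def not_all not_imp not_le by blast
  \<comment> \<open>This set contains the support of every translate of \<open>f\<close> by an
    element of \<open>A\<close>, so all norms become sums over one finite set.\<close>
  define F where "F = (\<Union>a\<in>A. (\<lambda>h. inv a \<otimes> h) ` {h \<in> carrier G. f h \<noteq> 0})"
  have "finite {h \<in> carrier G. f h \<noteq> 0}"
    using f by (simp only: fin_supp_def)
  then have F: "finite F" "F \<subseteq> carrier G"
    using A unfolding F_def by (blast, auto)
  have inF: "g \<in> F" if "g \<in> carrier G" "a \<in> A" "f (a \<otimes> g) \<noteq> 0" for a g
  proof -
    have "g = inv a \<otimes> (a \<otimes> g)" "a \<otimes> g \<in> carrier G"
      using A that by auto
    then show ?thesis
      using that unfolding F_def by blast
  qed
  have inF1: "g \<in> F" if "g \<in> carrier G" "f g \<noteq> 0" for g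
    using inF[of g \<one>] that A by simp
  have op: "walk_op xs f g = (\<Sum>a\<in>A. f (a \<otimes> g))" for g
    using xs by (simp add: walk_op_def sum_list_distinct_conv_sum_set)
  have N: "(\<Sum>g\<in>F. (f (a \<otimes> g))\<^sup>2) = sqnorm f" if "a \<in> A" for a
  proof -
    have "(\<Sum>g\<in>F. (f (a \<otimes> g))\<^sup>2) = sqnorm (\<lambda>g. f (a \<otimes> g))"
      by (rule sqnorm_eq[OF F, symmetric]) (rule inF[OF _ that])
    also have "\<dots> = sqnorm f"
      using that A by (intro sqnorm_translate) auto
    finally show ?thesis .
  qed
  have NT: "(\<Sum>g\<in>F. (\<Sum>a\<in>A. f (a \<otimes> g))\<^sup>2) = sqnorm (walk_op xs f)"
  proof -
    have "g \<in> F" if "g \<in> carrier G" "walk_op xs f g \<noteq> 0" for g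
      using that(2) unfolding op
      by (elim sum.not_neutral_contains_not_neutral) (rule inF[OF that(1)])
    then have "sqnorm (walk_op xs f) = (\<Sum>g\<in>F. (walk_op xs f g)\<^sup>2)"
      by (rule sqnorm_eq[OF F])
    then show ?thesis
      by (simp only: op)
  qed
  have identity: "(\<Sum>a\<in>A. \<Sum>b\<in>A. (f (a \<otimes> g) - f (b \<otimes> g))\<^sup>2) =
      2 * d * (\<Sum>a\<in>A. (f (a \<otimes> g))\<^sup>2) - 2 * (\<Sum>a\<in>A. f (a \<otimes> g))\<^sup>2" for g
  proof -
    have "(\<Sum>a\<in>A. \<Sum>b\<in>A. (f (a \<otimes> g) - f (b \<otimes> g))\<^sup>2) =
        (\<Sum>a\<in>A. \<Sum>b\<in>A. (f (a \<otimes> g))\<^sup>2 + (f (b \<otimes> g))\<^sup>2 - 2 * (f (a \<otimes> g) * f (b \<otimes> g)))"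
      by (simp only: power2_diff mult.assoc)
    also have "\<dots> = 2 * d * (\<Sum>a\<in>A. (f (a \<otimes> g))\<^sup>2) -
        2 * (\<Sum>a\<in>A. \<Sum>b\<in>A. f (a \<otimes> g) * f (b \<otimes> g))"
      by (simp add: sum.distrib sum_subtractf sum_distrib_left[symmetric] d_def)
    finally show ?thesis
      by (simp add: power2_eq_square sum_product)
  qed
  \<comment> \<open>Otherwise \<open>f\<close>, and with it \<open>walk_op xs f\<close>, vanishes on
    the carrier, against the strict inequality \<open>big\<close>.\<close>
  have "0 < sqnorm f"
  proof (rule ccontr)
    assume "\<not> 0 < sqnorm f"
    then have z: "sqnorm f = 0"
      using sqnorm_nonneg[of f] by linarith
    have "f g = 0" if "g \<in> carrier G" for g
      using square_le_sqnorm[OF f that] z by simp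
    then have "walk_op xs f g = 0" if "g \<in> carrier G" for g
      using that A unfolding op by (intro sum.neutral) auto
    then have "sqnorm (walk_op xs f) = 0"
      unfolding sqnorm_def by (intro sum.neutral) auto
    then show False
      using big z by simp
  qed
  moreover have "sqnorm (\<lambda>g. f (a \<otimes> g) - f g) \<le> \<epsilon> * sqnorm f" if a: "a \<in> A" for a
  proof -
    have "sqnorm (\<lambda>g. f (a \<otimes> g) - f g) = (\<Sum>g\<in>F. (f (a \<otimes> g) - f g)\<^sup>2)"
    proof (rule sqnorm_eq[OF F])
      fix g assume "g \<in> carrier G" "f (a \<otimes> g) - f g \<noteq> 0"
      then show "g \<in> F"
        using inF[OF _ a] inF1 by (cases "f g = 0") auto
    qed
    also have "\<dots> \<le> (\<Sum>g\<in>F. \<Sum>a\<in>A. \<Sum>b\<in>A. (f (a \<otimes> g) - f (b \<otimes> g))\<^sup>2)"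
    proof (rule sum_mono)
      fix g assume "g \<in> F"
      then have "(f (a \<otimes> g) - f g)\<^sup>2 = (f (a \<otimes> g) - f (\<one> \<otimes> g))\<^sup>2"
        using F by auto
      also have "\<dots> \<le> (\<Sum>b\<in>A. (f (a \<otimes> g) - f (b \<otimes> g))\<^sup>2)"
        using A by (intro member_le_sum) auto
      also have "\<dots> \<le> (\<Sum>a\<in>A. \<Sum>b\<in>A. (f (a \<otimes> g) - f (b \<otimes> g))\<^sup>2)"
        using A a by (intro member_le_sum[where f = "\<lambda>a. \<Sum>b\<in>A. (f (a \<otimes> g) - f (b \<otimes> g))\<^sup>2"])
          (auto intro!: sum_nonneg)
      finally show "(f (a \<otimes> g) - f g)\<^sup>2 \<le> \<dots>" .
    qed
    also have "\<dots> = 2 * d * (\<Sum>a\<in>A. \<Sum>g\<in>F. (f (a \<otimes> g))\<^sup>2) - 2 * sqnorm (walk_op xs f)"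
      unfolding identity NT[symmetric]
      by (subst sum.swap) (simp add: sum_subtractf sum_distrib_left)
    also have "\<dots> = 2 * d\<^sup>2 * sqnorm f - 2 * sqnorm (walk_op xs f)"
    proof -
      have "(\<Sum>a\<in>A. \<Sum>g\<in>F. (f (a \<otimes> g))\<^sup>2) = (\<Sum>a\<in>A. sqnorm f)"
        by (rule sum.cong[OF refl N])
      also have "\<dots> = d * sqnorm f"
        by (simp add: d_def)
      finally show ?thesis
        by (simp add: power2_eq_square)
    qed
    also have "\<dots> \<le> 2 * d\<^sup>2 * sqnorm f - 2 * (R\<^sup>2 * sqnorm f)"
      using big by simp
    also have "\<dots> = min \<epsilon> 1 * sqnorm f"
      unfolding R2 by (simp add: algebra_simps)
    also have "\<dots> \<le> \<epsilon> * sqnorm f"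
      using e by (intro mult_right_mono) auto
    finally show ?thesis .
  qed
  ultimately show ?thesis
    using f by blast
qed

text \<open>The mean has density \<open>f^2 / sqnorm f\<close>. A translation by \<open>a\<close>
  changes the density by a difference of two squares; factoring it and applying Cauchy-Schwarz
  bounds the change by the norm of the difference times the norm of the sum. With
  \<open>\<delta>^2 / 4\<close> in the hypothesis the first is at most \<open>\<delta> / 2\<close>
  and the second at most \<open>2\<close> times the norm of \<open>f\<close>.\<close>

lemma almost_invariant_mean:
  assumes A: "A \<subseteq> carrier G" and f: "fin_supp f" "0 < sqnorm f" and "0 < \<delta>"
    and inv: "\<And>a. a \<in> A \<Longrightarrow> sqnorm (\<lambda>g. f (a \<otimes> g) - f g) \<le> \<delta>\<^sup>2 / 4 * sqnorm f"
  shows "\<exists>m :: 'a set \<Rightarrow> real. (\<forall>B. 0 \<le> m B \<and> m B \<le> 1) \<and> m (carrier G) = 1 \<and>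
    (\<forall>B C. B \<inter> C = {} \<longrightarrow> m (B \<union> C) = m B + m C) \<and>
    (\<forall>a\<in>A. \<forall>B\<subseteq>carrier G. \<bar>m (a <#\<^bsub>G\<^esub> B) - m B\<bar> \<le> \<delta>)"
proof (intro exI conjI allI ballI impI)
  let ?S = "{g \<in> carrier G. f g \<noteq> 0}"
  let ?m = "\<lambda>B. (\<Sum>g\<in>?S \<inter> B. (f g)\<^sup>2) / sqnorm f"
  have S: "finite ?S"
    using f by (simp add: fin_supp_def)
  have tot: "(\<Sum>g\<in>?S. (f g)\<^sup>2) = sqnorm f"
    by (simp add: sqnorm_def)
  show "0 \<le> ?m B" for B
    using f by (auto intro!: divide_nonneg_pos sum_nonneg)
  show "?m B \<le> 1" for B
  proof -
    have "(\<Sum>g\<in>?S \<inter> B. (f g)\<^sup>2) \<le> sqnorm f"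
      unfolding tot[symmetric] using S by (intro sum_mono2) auto
    then show ?thesis
      using f by (simp add: divide_le_eq)
  qed
  have "?S \<inter> carrier G = ?S"
    by auto
  then show "?m (carrier G) = 1"
    using tot f by simp
  show "?m (B \<union> C) = ?m B + ?m C" if "B \<inter> C = {}" for B C
    using S that by (subst Int_Un_distrib, subst sum.union_disjoint) (auto simp: add_divide_distrib)
  show "\<bar>?m (a <#\<^bsub>G\<^esub> B) - ?m B\<bar> \<le> \<delta>" if a: "a \<in> A" and B: "B \<subseteq> carrier G" for a B
  proof -
    have ac: "a \<in> carrier G"
      using a A by auto
    define F where "F = ?S \<union> {g \<in> carrier G. f (a \<otimes> g) \<noteq> 0}"
    have F: "finite F"
      using S fin_supp_translate[OF f(1) ac] unfolding F_def fin_supp_def by (rule finite_UnI)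
    have F: "finite F" "F \<subseteq> carrier G"
      using F by (auto simp: F_def)
    have inF: "g \<in> F" if "g \<in> carrier G" "f g \<noteq> 0 \<or> f (a \<otimes> g) \<noteq> 0" for g
      using that by (auto simp: F_def)
    \<comment> \<open>Substituting \<open>a \<otimes> g\<close> for the summation variable moves the
      translation from the set to the function.\<close>
    have "(\<Sum>g\<in>?S \<inter> (a <#\<^bsub>G\<^esub> B). (f g)\<^sup>2) = (\<Sum>g\<in>{g \<in> B. f (a \<otimes> g) \<noteq> 0}. (f (a \<otimes> g))\<^sup>2)"
      using ac B
      by (intro sum.reindex_bij_witness[where j = "\<lambda>h. inv a \<otimes> h" and i = "\<lambda>g. a \<otimes> g"])
        (auto simp: l_coset_def subset_iff)
    also have "\<dots> = (\<Sum>g\<in>F \<inter> B. (f (a \<otimes> g))\<^sup>2)"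
      using F B by (intro sum.mono_neutral_left) (auto simp: F_def)
    finally have 1: "(\<Sum>g\<in>?S \<inter> (a <#\<^bsub>G\<^esub> B). (f g)\<^sup>2) = (\<Sum>g\<in>F \<inter> B. (f (a \<otimes> g))\<^sup>2)" .
    have 2: "(\<Sum>g\<in>?S \<inter> B. (f g)\<^sup>2) = (\<Sum>g\<in>F \<inter> B. (f g)\<^sup>2)"
      using F by (intro sum.mono_neutral_left) (auto simp: F_def)
    let ?u = "\<lambda>g. f (a \<otimes> g) - f g" and ?v = "\<lambda>g. f (a \<otimes> g) + f g"
    have "\<bar>(\<Sum>g\<in>?S \<inter> (a <#\<^bsub>G\<^esub> B). (f g)\<^sup>2) - (\<Sum>g\<in>?S \<inter> B. (f g)\<^sup>2)\<bar> =
        \<bar>\<Sum>g\<in>F \<inter> B. ?u g * ?v g\<bar>"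
      unfolding 1 2 by (simp add: sum_subtractf[symmetric] power2_eq_square algebra_simps)
    also have "\<dots> \<le> (\<Sum>g\<in>F \<inter> B. \<bar>?u g\<bar> * \<bar>?v g\<bar>)"
      by (rule order_trans[OF sum_abs]) (simp add: abs_mult)
    also have "\<dots> \<le> (\<Sum>g\<in>F. \<bar>?u g\<bar> * \<bar>?v g\<bar>)"
      using F by (intro sum_mono2) auto
    also have "\<dots> \<le> \<delta> * sqnorm f"
    proof (rule power2_le_imp_le)
      have "(\<Sum>g\<in>F. \<bar>?u g\<bar> * \<bar>?v g\<bar>)\<^sup>2 \<le> (\<Sum>g\<in>F. \<bar>?u g\<bar>\<^sup>2) * (\<Sum>g\<in>F. \<bar>?v g\<bar>\<^sup>2)"
        by (rule Cauchy_Schwarz_ineq_sum)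
      also have "\<dots> = sqnorm ?u * sqnorm ?v"
      proof -
        have "sqnorm ?u = (\<Sum>g\<in>F. (?u g)\<^sup>2)" "sqnorm ?v = (\<Sum>g\<in>F. (?v g)\<^sup>2)"
          by (rule sqnorm_eq[OF F], rule inF, assumption, force)+
        then show ?thesis
          by (simp only: power2_abs)
      qed
      also have "\<dots> \<le> (\<delta>\<^sup>2 / 4 * sqnorm f) * (4 * sqnorm f)"
        using sqnorm_add_le[OF fin_supp_translate[OF f(1) ac] f(1)] a f(2)
        by (intro mult_mono inv) (auto simp: sqnorm_translate[OF ac])
      finally show "(\<Sum>g\<in>F. \<bar>?u g\<bar> * \<bar>?v g\<bar>)\<^sup>2 \<le> (\<delta> * sqnorm f)\<^sup>2"
        by (simp add: power2_eq_square mult_ac)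
      show "0 \<le> \<delta> * sqnorm f"
        using \<open>0 < \<delta>\<close> by simp
    qed
    finally show ?thesis
      using f by (simp add: diff_divide_distrib[symmetric] abs_divide divide_le_eq)
  qed
qed

section \<open>Kesten's criterion\<close>

text \<open>Compactness: the closed sets of means that are invariant up to
  \<open>1 / (n + 1)\<close> decrease with \<open>n\<close> and meet the cube, so they have a common
  point in it. This mean is exactly invariant under the generators, hence under the whole
  group.\<close>

lemma amenable_if_approximately:
  assumes A: "A \<subseteq> carrier G" "generate G A = carrier G"
    and approx: "\<And>\<delta>. 0 < \<delta> \<Longrightarrow> \<exists>m :: 'a set \<Rightarrow> real. (\<forall>B. 0 \<le> m B \<and> m B \<le> 1) \<and>
      m (carrier G) = 1 \<and> (\<forall>B C. B \<inter> C = {} \<longrightarrow> m (B \<union> C) = m B + m C) \<and>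
      (\<forall>a\<in>A. \<forall>B\<subseteq>carrier G. \<bar>m (a <#\<^bsub>G\<^esub> B) - m B\<bar> \<le> \<delta>)"
  shows "amenable G"
proof -
  define K where "K = {m :: 'a set \<Rightarrow> real. \<forall>B. 0 \<le> m B \<and> m B \<le> 1}"
  define C where "C n = {m :: 'a set \<Rightarrow> real. m (carrier G) = 1} \<inter>
    (\<Inter>(B, B')\<in>{(B, B'). B \<inter> B' = {}}. {m. m (B \<union> B') = m B + m B'}) \<inter>
    (\<Inter>a\<in>A. \<Inter>B\<in>Pow (carrier G). {m. \<bar>m (a <#\<^bsub>G\<^esub> B) - m B\<bar> \<le> inverse (real (Suc n))})" for n
  have cont: "continuous_on UNIV (\<lambda>m :: 'a set \<Rightarrow> real. m B)" for B
    by simp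
  \<comment> \<open>Every condition compares finitely many values of \<open>m\<close>, and these
    depend continuously on \<open>m\<close> for pointwise convergence.\<close>
  have "closed (C n)" for n
    unfolding C_def split_beta
    by (intro closed_Int closed_INT ballI closed_Collect_eq closed_Collect_le
        continuous_intros cont)
  moreover have "K \<inter> \<Inter>(C ` I) \<noteq> {}" if "finite I" for I
  proof -
    obtain n where n: "\<And>i. i \<in> I \<Longrightarrow> i \<le> n"
      using Max_ge[OF \<open>finite I\<close>] by blast
    obtain m where m: "\<forall>B. 0 \<le> m B \<and> m B \<le> 1" "m (carrier G) = 1"
      "\<forall>B C. B \<inter> C = {} \<longrightarrow> m (B \<union> C) = m B + m C"
      "\<forall>a\<in>A. \<forall>B\<subseteq>carrier G. \<bar>m (a <#\<^bsub>G\<^esub> B) - m B\<bar> \<le> inverse (real (Suc n))"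
      using approx[of "inverse (real (Suc n))"] by (auto simp del: of_nat_Suc)
    have "m \<in> C i" if "i \<in> I" for i
    proof -
      have "inverse (real (Suc n)) \<le> inverse (real (Suc i))"
        using n[OF that] by (intro le_imp_inverse_le) auto
      then show ?thesis
        using m(2,3) order_trans[OF m(4)[rule_format]] unfolding C_def by auto
    qed
    then show ?thesis
      using m(1) unfolding K_def by blast
  qed
  moreover have "compact K"
    unfolding K_def by (rule compact_unit_cube)
  ultimately have "K \<inter> \<Inter>(range C) \<noteq> {}"
    using \<open>\<And>n. closed (C n)\<close> by (intro compact_imp_fip_image[of K UNIV C])
  then obtain m where m: "m \<in> K" "\<And>n. m \<in> C n"
    by blast
  have nonneg: "0 \<le> m B" for B
    using m(1) by (simp add: K_def)
  have one: "m (carrier G) = 1"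
    using m(2)[of 0] by (simp add: C_def)
  have add: "m (B \<union> B') = m B + m B'" if "B \<inter> B' = {}" for B B'
    using m(2)[of 0] that by (auto simp: C_def)
  have A_inv: "m (a <#\<^bsub>G\<^esub> B) = m B" if "a \<in> A" "B \<subseteq> carrier G" for a B
  proof (rule ccontr)
    assume "m (a <#\<^bsub>G\<^esub> B) \<noteq> m B"
    then obtain n where n: "inverse (real (Suc n)) < \<bar>m (a <#\<^bsub>G\<^esub> B) - m B\<bar>"
      using reals_Archimedean[of "\<bar>m (a <#\<^bsub>G\<^esub> B) - m B\<bar>"] by auto
    moreover have "\<bar>m (a <#\<^bsub>G\<^esub> B) - m B\<bar> \<le> inverse (real (Suc n))"
      using m(2)[of n] that unfolding C_def by blast
    ultimately show False
      by linarith
  qed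
  have "m (g <#\<^bsub>G\<^esub> B) = m B" if "g \<in> generate G A" "B \<subseteq> carrier G" for g B
    using that
  proof (induction arbitrary: B rule: generate.induct)
    case one
    then show ?case by (simp add: lcos_mult_one)
  next
    case (incl h)
    then show ?case by (rule A_inv)
  next
    case (inv h)
    then have h: "h \<in> carrier G"
      using A by auto
    then have "inv h <#\<^bsub>G\<^esub> B \<subseteq> carrier G"
      using inv by (simp add: l_coset_subset_G)
    \<comment> \<open>Invariance under \<open>h\<close> on the set translated by
      \<open>inv h\<close> is invariance under \<open>inv h\<close> on \<open>B\<close>.\<close>
    then have "m (h <#\<^bsub>G\<^esub> (inv h <#\<^bsub>G\<^esub> B)) = m (inv h <#\<^bsub>G\<^esub> B)"
      using inv by (intro A_inv)
    moreover have "h <#\<^bsub>G\<^esub> (inv h <#\<^bsub>G\<^esub> B) = B"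
      using inv h by (simp add: lcos_m_assoc lcos_mult_one)
    ultimately show ?case by simp
  next
    case (eng h1 h2)
    then have h: "h1 \<in> carrier G" "h2 \<in> carrier G"
      using A(2) by auto
    then have "h2 <#\<^bsub>G\<^esub> B \<subseteq> carrier G"
      using eng by (simp add: l_coset_subset_G)
    then show ?case
      using eng h by (simp add: lcos_m_assoc[symmetric])
  qed
  then show ?thesis
    unfolding amenable_def additive_def A(2) by (intro exI[of _ m]) (simp add: nonneg one add)
qed

text \<open>The half of Kesten's theorem in which a missing spectral gap forces amenability: if no
  \<open>R\<close> below the degree bounded the norm, almost invariant vectors would exist to any
  precision, and with them almost invariant means.\<close>

lemma nonamenable_norm_bound:
  assumes A: "finite A" "A \<subseteq> carrier G" "\<one> \<in> A" "generate G A = carrier G"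
    and xs: "set xs = A" "distinct xs" and "\<not> amenable G"
  shows "\<exists>R. 0 \<le> R \<and> R < real (card A) \<and> norm_bound xs R"
proof (rule ccontr)
  assume nb: "\<not> ?thesis"
  have "amenable G"
  proof (rule amenable_if_approximately[OF A(2,4)])
    fix \<delta> :: real assume \<delta>: "0 < \<delta>"
    have "\<exists>f. fin_supp f \<and> 0 < sqnorm f \<and>
        (\<forall>a\<in>A. sqnorm (\<lambda>g. f (a \<otimes> g) - f g) \<le> \<delta>\<^sup>2 / 4 * sqnorm f)"
      by (rule almost_invariant_vector[OF A(1-3) xs]) (use nb \<delta> in auto)
    then obtain f where f: "fin_supp f" "0 < sqnorm f"
        "\<And>a. a \<in> A \<Longrightarrow> sqnorm (\<lambda>g. f (a \<otimes> g) - f g) \<le> \<delta>\<^sup>2 / 4 * sqnorm f"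
      by blast
    from almost_invariant_mean[OF A(2) f(1,2) \<delta> f(3)]
    show "\<exists>m :: 'a set \<Rightarrow> real. (\<forall>B. 0 \<le> m B \<and> m B \<le> 1) \<and>
      m (carrier G) = 1 \<and> (\<forall>B C. B \<inter> C = {} \<longrightarrow> m (B \<union> C) = m B + m C) \<and>
      (\<forall>a\<in>A. \<forall>B\<subseteq>carrier G. \<bar>m (a <#\<^bsub>G\<^esub> B) - m B\<bar> \<le> \<delta>)"
      by blast
  qed
  then show False
    using \<open>\<not> amenable G\<close> by simp
qed

section \<open>Multi-sets of words and the ratio of degree to norm\<close>

lemma norm_bound_power:
  assumes xs: "set xs \<subseteq> carrier G" "\<one> \<in> set xs" "norm_bound xs R" "norm_bound (map (m_inv G) xs) R"
  shows "\<exists>ys. set xs \<subseteq> set ys \<and> set ys \<subseteq> carrier G \<and> \<one> \<in> set ys \<and> length ys = length xs ^ Suc k \<and>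
    norm_bound ys (R ^ Suc k) \<and> norm_bound (map (m_inv G) ys) (R ^ Suc k)"
proof (induction k)
  case 0
  then show ?case using assms by (intro exI[of _ xs]) auto
next
  case (Suc k)
  then obtain ys where ys: "set xs \<subseteq> set ys" "set ys \<subseteq> carrier G" "\<one> \<in> set ys"
    "length ys = length xs ^ Suc k" "norm_bound ys (R ^ Suc k)"
    "norm_bound (map (m_inv G) ys) (R ^ Suc k)"
    by blast
  have one: "x = x \<otimes> \<one>" if "x \<in> set xs" for x
    using that xs(1) by auto
  \<comment> \<open>Padding a letter with \<open>\<one>\<close> keeps \<open>xs\<close> inside the
    new list, so that the words still generate. The exponent \<open>Suc k\<close> leaves out the
    list consisting of the empty word alone, for which this could fail.\<close>
  have "set xs \<subseteq> set (list_mult xs ys)"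
    unfolding set_list_mult using one ys(3) by blast
  moreover have "set (list_mult xs ys) \<subseteq> carrier G"
    unfolding set_list_mult using xs(1) ys(2) by auto
  moreover have "length (list_mult xs ys) = length xs ^ Suc (Suc k)"
    using ys(4) by (simp add: length_list_mult)
  moreover have "norm_bound (list_mult xs ys) (R ^ Suc (Suc k))"
    using norm_bound_list_mult[OF xs(3) ys(5) xs(1) ys(2)] by simp
  moreover have "norm_bound (map (m_inv G) (list_mult xs ys)) (R ^ Suc (Suc k))"
    using norm_bound_inv_list_mult[OF xs(4) ys(6) xs(1) ys(2)] by simp
  ultimately show ?case
    using xs(2) by blast
qed

lemma finite_symmetric_generators:
  assumes "finitely_generated G"
  obtains A where "finite A" "A \<subseteq> carrier G" "\<one> \<in> A" "m_inv G ` A = A" "generate G A = carrier G"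
proof -
  obtain B where B: "finite B" "B \<subseteq> carrier G" "generate G B = carrier G"
    using assms unfolding finitely_generated_def by blast
  define A where "A = insert \<one> (B \<union> m_inv G ` B)"
  have A: "A \<subseteq> carrier G"
    using B by (auto simp: A_def)
  show thesis
  proof
    show "finite A" "A \<subseteq> carrier G" "\<one> \<in> A"
      using A B by (auto simp: A_def)
    have "m_inv G ` A \<subseteq> A"
      using B by (auto simp: A_def)
    moreover have "x \<in> m_inv G ` A" if "x \<in> A" for x
      using that A calculation by (intro image_eqI[of _ _ "inv x"]) auto
    ultimately show "m_inv G ` A = A"
      by blast
    have "carrier G \<subseteq> generate G A"
      unfolding B(3)[symmetric] by (rule mono_generate) (auto simp: A_def)
    then show "generate G A = carrier G"
      using generate_incl[OF A] by blast
  qed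
qed

text \<open>Length and norm bound of the lists of words are both multiplicative, so a ratio above
  \<open>1\<close> for the letters becomes as large as desired. Appending the inverses doubles the
  length as well as the bound and leaves the ratio as it is.\<close>

lemma nonamenable_large_ratio:
  assumes "finitely_generated G" "\<not> amenable G"
  shows "\<exists>xs R. set xs \<subseteq> carrier G \<and> generate G (set xs) = carrier G \<and> 1 \<le> R \<and>
    norm_bound (xs @ map (m_inv G) xs) (2 * R) \<and> C * R \<le> real (length xs)"
proof -
  obtain A where A: "finite A" "A \<subseteq> carrier G" "\<one> \<in> A" "m_inv G ` A = A" "generate G A = carrier G"
    using finite_symmetric_generators[OF assms(1)] .
  obtain xs where xs: "set xs = A" "distinct xs"
    using finite_distinct_list[OF A(1)] by blast
  obtain R where R: "0 \<le> R" "R < real (card A)" "norm_bound xs R"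
    using nonamenable_norm_bound[OF A(1-3,5) xs assms(2)] by blast
  \<comment> \<open>As \<open>A\<close> is closed under inversion, both lists run through
    \<open>A\<close> exactly once.\<close>
  have "walk_op (map (m_inv G) xs) f = walk_op xs f" for f
  proof
    fix g
    have inj: "inj_on (m_inv G) A"
      using A(2) by (intro inj_onI) (metis inv_inv subsetD)
    have "walk_op (map (m_inv G) xs) f g = (\<Sum>x\<in>A. f (inv x \<otimes> g))"
      using xs by (simp add: walk_op_def o_def sum_list_distinct_conv_sum_set)
    also have "\<dots> = (\<Sum>x\<in>m_inv G ` A. f (x \<otimes> g))"
      using inj by (simp add: sum.reindex)
    also have "\<dots> = walk_op xs f g"
      using xs A(4) by (simp add: walk_op_def sum_list_distinct_conv_sum_set)
    finally show "walk_op (map (m_inv G) xs) f g = walk_op xs f g" .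
  qed
  then have R': "norm_bound (map (m_inv G) xs) R"
    using R(3) by (simp add: norm_bound_def)
  have xsC: "set xs \<subseteq> carrier G" "\<one> \<in> set xs"
    using A xs by auto
  have R1: "1 \<le> R"
    using norm_bound_ge_1[OF R(3) xsC R(1)] .
  have len: "length xs = card A"
    using xs distinct_card by metis
  have "1 < real (length xs) / R"
    using R R1 len by simp
  then obtain k where k: "C < (real (length xs) / R) ^ k"
    using real_arch_pow by blast
  also have "\<dots> \<le> (real (length xs) / R) ^ Suc k"
    using \<open>1 < real (length xs) / R\<close> by (intro power_increasing) auto
  finally have k: "C * R ^ Suc k \<le> real (length xs ^ Suc k)"
    using R1 unfolding power_divide by (simp add: less_divide_eq del: power_Suc)
  obtain ys where ys: "set xs \<subseteq> set ys" "set ys \<subseteq> carrier G" "length ys = length xs ^ Suc k"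
    "norm_bound ys (R ^ Suc k)" "norm_bound (map (m_inv G) ys) (R ^ Suc k)"
    using norm_bound_power[OF xsC R(3) R', of k] by blast
  have inv: "set (map (m_inv G) ys) \<subseteq> carrier G"
    using ys(2) by auto
  have "carrier G \<subseteq> generate G (set ys)"
    unfolding A(5)[symmetric] xs(1)[symmetric] by (rule mono_generate[OF ys(1)])
  then have "generate G (set ys) = carrier G"
    using generate_incl[OF ys(2)] by blast
  moreover have "1 \<le> R ^ Suc k"
    using R1 by (rule one_le_power)
  ultimately show ?thesis
    using norm_bound_append[OF ys(4,5,2) inv] ys(2,3) k by metis
qed

end

section \<open>A lower bound for the expected degree\<close>

context bidirected_digraph
begin

section \<open>Closed walks and simple cycles\<close>

lemma awalk_rev:
  assumes "awalk u p v"
  shows "awalk v (rev (map arev p)) u"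
  using assms
proof (induction p arbitrary: u)
  case Nil
  then show ?case by (auto simp: awalk_Nil_iff)
next
  case (Cons a p)
  then have a: "a \<in> arcs G" "u = tail G a" and IH: "awalk v (rev (map arev p)) (head G a)"
    by (auto simp: awalk_Cons_iff)
  have "awalk (head G a) [arev a] u"
    using a by (auto simp: awalk_Cons_iff awalk_Nil_iff)
  with IH show ?case
    by (simp only: list.map rev.simps awalk_appendI)
qed

lemma awalk_split:
  assumes "awalk u (p @ a # q) v"
  shows "awalk u p (tail G a)" "a \<in> arcs G" "awalk (head G a) q v"
proof -
  have "awalk u p (awlast u p)" "awalk (awlast u p) (a # q) v"
    using assms by auto
  then show "awalk u p (tail G a)" "a \<in> arcs G" "awalk (head G a) q v"
    unfolding awalk_Cons_iff by auto
qed

lemma awalk_rotate: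
  assumes "awalk u (p @ a # q) u"
  shows "awalk (tail G a) (a # q @ p) (tail G a)"
  using awalk_split[OF assms] by (simp only: awalk_Cons_iff awalk_appendI simp_thms)

lemma head_last_awalk:
  assumes "awalk u p v" "p \<noteq> []"
  shows "head G (last p) = v"
  using assms awlast_of_awalk[OF assms(1)] by (simp add: awalk_verts_conv)

lemma cycle_edges_rev: "cycle_edges arev (rev (map arev p)) = cycle_edges arev p"
proof -
  have "{arev a, arev (arev a)} = {a, arev a}" for a
    by auto
  then show ?thesis
    by (simp add: cycle_edges_def image_image)
qed

text \<open>A cycle that traverses the edge as \<open>arev a\<close> is reversed first; then it is
  rotated to start with \<open>a\<close>. Both operations keep the length and the set of edges.
  Removal of an edge is thereby traced to closed walks with prescribed first arc.\<close>

lemma simple_cycle_through_arc: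
  assumes p: "simple_cycle G arev p" and a: "{a, arev a} \<in> cycle_edges arev p"
  shows "\<exists>q. awalk (tail G a) q (tail G a) \<and> q \<noteq> [] \<and> hd q = a \<and>
    length q = length p \<and> cycle_edges arev q = cycle_edges arev p"
proof -
  obtain u where u: "awalk u p u"
    using p unfolding simple_cycle_def cycle_def by blast
  have "a \<in> set p \<or> arev a \<in> set p"
    using a by (auto simp: cycle_edges_def doubleton_eq_iff)
  then have "\<exists>p'. awalk u p' u \<and> a \<in> set p' \<and> length p' = length p \<and>
      cycle_edges arev p' = cycle_edges arev p"
  proof
    assume "a \<in> set p"
    with u show ?thesis by blast
  next
    assume "arev a \<in> set p"
    then have "a \<in> set (rev (map arev p))"
      by (force simp: image_iff)
    with awalk_rev[OF u] cycle_edges_rev[of p] show ?thesis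
      by (metis length_map length_rev)
  qed
  then obtain p' where p': "awalk u p' u" "a \<in> set p'" "length p' = length p"
      "cycle_edges arev p' = cycle_edges arev p"
    by blast
  then obtain r s where rs: "p' = r @ a # s"
    by (auto dest: split_list)
  have "awalk (tail G a) (a # s @ r) (tail G a)"
    using awalk_rotate p'(1) rs by blast
  moreover have "cycle_edges arev (a # s @ r) = cycle_edges arev p'"
    unfolding rs cycle_edges_def by auto
  ultimately show ?thesis
    using p' rs by (intro exI[of _ "a # s @ r"]) auto
qed

text \<open>All heads are distinct, so an edge could be repeated only in opposite directions, as
  \<open>a\<close> and \<open>arev a\<close>. The two stretches between these arcs are closed walks,
  and a nonempty one would repeat a head; what remains is the excluded back-and-forth walk. So a
  simple cycle of length \<open>n\<close> carries \<open>n\<close> independent labels.\<close>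

lemma card_cycle_edges:
  assumes p: "simple_cycle G arev p"
  shows "card (cycle_edges arev p) = length p"
proof -
  obtain u where u: "awalk u p u" "distinct (tl (awalk_verts u p))" "p \<noteq> []"
    using p unfolding simple_cycle_def cycle_def by blast
  have heads: "distinct (map (head G) p)"
    using u awalk_verts_conv'[of u p u] by (auto simp: awalk_def)
  have arcs: "set p \<subseteq> arcs G"
    using u(1) by (auto simp: awalk_def)
  have "inj_on (\<lambda>a. {a, arev a}) (set p)"
  proof (intro inj_onI, rule ccontr)
    fix a b assume ab: "a \<in> set p" "b \<in> set p" "{a, arev a} = {b, arev b}" "a \<noteq> b"
    then have b: "b = arev a" and a_arc: "a \<in> arcs G" and neq: "arev a \<noteq> a"
      using arcs arev_neq by (auto simp: doubleton_eq_iff)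
    obtain r s where rs: "p = r @ a # s"
      using ab(1) by (auto dest: split_list)
    then have "arev a \<in> set (s @ r)"
      using ab(2) b neq by auto
    from split_list[OF this] obtain t1 t2 where t: "s @ r = t1 @ arev a # t2"
      by blast
    have "distinct (map (head G) (a # s @ r))"
      using heads unfolding rs by auto
    then have dist: "distinct (map (head G) (a # t1 @ arev a # t2))"
      unfolding t by simp
    have "awalk (tail G a) (a # s @ r) (tail G a)"
      using awalk_rotate u(1) unfolding rs by blast
    then have "awalk (head G a) (t1 @ arev a # t2) (tail G a)"
      unfolding t by (simp only: awalk_Cons_iff)
    from awalk_split[OF this] have t1: "awalk (head G a) t1 (head G a)"
      and t2: "awalk (tail G a) t2 (tail G a)"
      using a_arc by auto
    have "t1 = []"
    proof (rule ccontr)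
      assume "t1 \<noteq> []"
      then have "head G a \<in> head G ` set t1"
        using head_last_awalk[OF t1] last_in_set by (metis image_eqI)
      then show False
        using dist by simp
    qed
    moreover have "t2 = []"
    proof (rule ccontr)
      assume "t2 \<noteq> []"
      then have "head G (arev a) \<in> head G ` set t2"
        using head_last_awalk[OF t2] last_in_set head_arev[OF a_arc] by (metis image_eqI)
      then show False
        using dist by simp
    qed
    ultimately have "s @ r = [arev a]"
      using t by simp
    \<comment> \<open>Undoing the rotation may put \<open>arev a\<close> first; since
      \<open>arev\<close> is an involution, that list has the excluded form as well.\<close>
    then have "p = [a, arev a] \<or> p = [arev a, arev (arev a)]"
      unfolding rs by (auto simp: append_eq_Cons_conv)
    then show False
      using p unfolding simple_cycle_def by blast
  qed
  then have "card (cycle_edges arev p) = card (set p)"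
    unfolding cycle_edges_def by (rule card_image)
  also have "\<dots> = length p"
    using heads by (simp add: distinct_map distinct_card)
  finally show ?thesis .
qed

lemma cycle_edges_subset:
  assumes "set p \<subseteq> arcs G"
  shows "cycle_edges arev p \<subseteq> edges G arev"
  using assms by (auto simp: cycle_edges_def edges_def)

lemma finite_cycle_edges: "finite (cycle_edges arev p)"
  by (simp add: cycle_edges_def)

lemma simple_cycle_arcs:
  assumes "simple_cycle G arev p"
  shows "set p \<subseteq> arcs G"
  using assms unfolding simple_cycle_def cycle_def awalk_def by blast

section \<open>Random labels and the removal of edges\<close>

lemma prob_space_labels: "prob_space (label_space G arev)"
  unfolding label_space_def
  by (intro prob_space_PiM prob_space_restrict_space) auto

lemma measurable_label [measurable]:
  assumes "e \<in> edges G arev"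
  shows "(\<lambda>x. x e) \<in> borel_measurable (label_space G arev)"
proof -
  have "(\<lambda>x. x e) \<in> measurable (label_space G arev) (restrict_space lborel {0..1::real})"
    using assms unfolding label_space_def by (rule measurable_component_singleton)
  then show ?thesis
    by (simp add: measurable_restrict_space2_iff)
qed

lemma sets_labels_le:
  assumes "finite J" "J \<subseteq> edges G arev"
  shows "{x \<in> space (label_space G arev). \<forall>f\<in>J. x f \<le> t} \<in> sets (label_space G arev)"
proof -
  have [measurable]: "f \<in> J \<Longrightarrow> (\<lambda>x. x f) \<in> borel_measurable (label_space G arev)" for f
    using assms by (intro measurable_label) auto
  show ?thesis
    using assms by measurable
qed

text \<open>The event is a cylinder over the finite set \<open>J\<close>, and the labels are
  independent and uniform.\<close>

lemma measure_labels_le: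
  assumes "finite J" "J \<subseteq> edges G arev" "0 \<le> t" "t \<le> 1"
  shows "measure (label_space G arev) {x \<in> space (label_space G arev). \<forall>f\<in>J. x f \<le> t} = t ^ card J"
proof -
  let ?U = "restrict_space lborel {0..1::real}"
  have pU: "prob_space ?U"
    by (intro prob_space_restrict_space) auto
  interpret product_prob_space "\<lambda>_. ?U" "edges G arev"
    using pU by (simp add: product_prob_space_def product_prob_space_axioms_def
        product_sigma_finite_def prob_space_imp_sigma_finite)
  have sets: "{0..t} \<in> sets ?U"
    using assms by (auto simp: sets_restrict_space intro!: image_eqI[of _ _ "{0..t}"])
  have "{x \<in> space (label_space G arev). \<forall>f\<in>J. x f \<le> t} =
      prod_emb (edges G arev) (\<lambda>_. ?U) J (PiE J (\<lambda>_. {0..t}))"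
  proof (intro Set.set_eqI iffI)
    fix x assume x: "x \<in> {x \<in> space (label_space G arev). \<forall>f\<in>J. x f \<le> t}"
    then have "x f \<in> {0..1}" if "f \<in> J" for f
      using that assms(2) by (auto simp: label_space_def space_PiM dest!: PiE_mem)
    with x show "x \<in> prod_emb (edges G arev) (\<lambda>_. ?U) J (PiE J (\<lambda>_. {0..t}))"
      by (simp add: prod_emb_def label_space_def space_PiM restrict_PiE_iff)
  next
    fix x assume "x \<in> prod_emb (edges G arev) (\<lambda>_. ?U) J (PiE J (\<lambda>_. {0..t}))"
    then show "x \<in> {x \<in> space (label_space G arev). \<forall>f\<in>J. x f \<le> t}"
      by (simp add: prod_emb_def label_space_def space_PiM restrict_PiE_iff Pi_iff)
  qed
  then have "measure (label_space G arev) {x \<in> space (label_space G arev). \<forall>f\<in>J. x f \<le> t} =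
      (\<Prod>f\<in>J. measure ?U {0..t})"
    unfolding label_space_def using assms sets by (simp add: measure_PiM_emb)
  also have "measure ?U {0..t} = t"
    using assms by (simp add: measure_restrict_space)
  finally show ?thesis
    by simp
qed

lemma countable_simple_cycles:
  assumes "countable (arcs G)"
  shows "countable {p. simple_cycle G arev p}"
  using simple_cycle_arcs
  by (intro countable_subset[OF _ countable_lists[OF assms]]) (auto simp: lists_eq_set)

definition removed :: "'b set \<Rightarrow> ('b set \<Rightarrow> real) set" where
  "removed e = {x \<in> space (label_space G arev). \<exists>p. simple_cycle G arev p \<and>
     e \<in> cycle_edges arev p \<and> (\<forall>f\<in>cycle_edges arev p. x f \<le> x e)}"

text \<open>The event is a union over simple cycles, which are finite lists of arcs and hence
  countable in number, of finite intersections of comparisons between two labels.\<close>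

lemma sets_removed:
  assumes "countable (arcs G)"
  shows "removed e \<in> sets (label_space G arev)"
proof -
  let ?M = "label_space G arev"
  have "{x \<in> space ?M. \<forall>f\<in>cycle_edges arev p. x f \<le> x e} \<in> sets ?M"
    if p: "simple_cycle G arev p" "e \<in> cycle_edges arev p" for p
  proof -
    have sub: "cycle_edges arev p \<subseteq> edges G arev"
      by (intro cycle_edges_subset simple_cycle_arcs p)
    have [measurable]: "f \<in> cycle_edges arev p \<Longrightarrow> (\<lambda>x. x f) \<in> borel_measurable ?M" for f
      using sub by (intro measurable_label) auto
    have fin: "finite (cycle_edges arev p)"
      by (rule finite_cycle_edges)
    have "{x \<in> space ?M. x f \<le> x e} \<in> sets ?M" if "f \<in> cycle_edges arev p" for f
      using that p(2) by measurable
    then show ?thesis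
      using fin by (intro sets.sets_Collect_finite_All) auto
  qed
  then have "(\<Union>p\<in>{p. simple_cycle G arev p} \<inter> {p. e \<in> cycle_edges arev p}.
      {x \<in> space ?M. \<forall>f\<in>cycle_edges arev p. x f \<le> x e}) \<in> sets ?M"
    using countable_simple_cycles[OF assms]
    by (intro sets.countable_UN') auto
  also have "(\<Union>p\<in>{p. simple_cycle G arev p} \<inter> {p. e \<in> cycle_edges arev p}.
      {x \<in> space ?M. \<forall>f\<in>cycle_edges arev p. x f \<le> x e}) = removed e"
    unfolding removed_def by blast
  finally show ?thesis .
qed

lemma fmsf_map_iff:
  assumes "e \<in> edges G arev" "x \<in> space (label_space G arev)"
  shows "fmsf_map G arev x e \<longleftrightarrow> x \<notin> removed e"
  using assms unfolding fmsf_map_def removed_def by simp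

lemma measurable_fmsf_map:
  assumes "countable (arcs G)"
  shows "fmsf_map G arev \<in> measurable (label_space G arev) (subgraph_space G arev)"
  unfolding fmsf_map_def subgraph_space_def
proof (rule measurable_restrict)
  fix e assume "e \<in> edges G arev"
  have "Measurable.pred (label_space G arev) (\<lambda>x. x \<notin> removed e)"
    using sets_removed[OF assms, of e] by measurable
  also have "?this \<longleftrightarrow> (\<lambda>x. \<not> (\<exists>p. simple_cycle G arev p \<and> e \<in> cycle_edges arev p \<and>
      (\<forall>f\<in>cycle_edges arev p. x f \<le> x e))) \<in> measurable (label_space G arev) (count_space UNIV)"
    by (rule measurable_cong) (simp add: removed_def)
  finally show "\<dots>" .
qed

text \<open>Linearity of expectation, after the integral has been pulled back to the labels. The sum
  runs over arcs and not over edges: both arcs of a loop leave \<open>v\<close>, so a loop counts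
  twice.\<close>

lemma expected_degree_eq:
  assumes "countable (arcs G)" "finite (out_arcs G v)"
  shows "expected_degree G arev v =
    (\<Sum>a\<in>out_arcs G v. 1 - measure (label_space G arev) (removed {a, arev a}))"
proof -
  let ?M = "label_space G arev"
  interpret prob_space ?M
    by (rule prob_space_labels)
  have edge: "{a, arev a} \<in> edges G arev" if "a \<in> out_arcs G v" for a
    using that by (auto simp: edges_def)
  have deg: "real (out_degree (spanning_subgraph G arev \<omega>) v) =
      (\<Sum>a\<in>out_arcs G v. if \<omega> {a, arev a} then 1 else 0)" for \<omega>
  proof -
    have "out_arcs (spanning_subgraph G arev \<omega>) v = {a \<in> out_arcs G v. \<omega> {a, arev a}}"
      by (auto simp: out_arcs_def spanning_subgraph_def)
    then show ?thesis
      using assms(2) by (simp add: out_degree_def sum.If_cases Int_def)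
  qed
  have "(\<lambda>\<omega>. \<Sum>a\<in>out_arcs G v. if \<omega> {a, arev a} then 1 else 0 :: real)
      \<in> borel_measurable (subgraph_space G arev)"
  proof (rule borel_measurable_sum)
    fix a assume "a \<in> out_arcs G v"
    then have "(\<lambda>\<omega>. \<omega> {a, arev a}) \<in> measurable (subgraph_space G arev) (count_space UNIV)"
      unfolding subgraph_space_def by (intro measurable_component_singleton edge)
    then show "(\<lambda>\<omega>. if \<omega> {a, arev a} then 1 else 0 :: real) \<in> borel_measurable (subgraph_space G arev)"
      by measurable
  qed
  then have "expected_degree G arev v =
      (\<integral>x. (\<Sum>a\<in>out_arcs G v. if fmsf_map G arev x {a, arev a} then 1 else 0) \<partial>?M)"
    unfolding expected_degree_def FMSF_def deg
    by (intro integral_distr measurable_fmsf_map assms(1))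
  also have "\<dots> = (\<integral>x. (\<Sum>a\<in>out_arcs G v. indicator (space ?M - removed {a, arev a}) x) \<partial>?M)"
    using edge by (intro Bochner_Integration.integral_cong sum.cong)
      (auto simp: fmsf_map_iff indicator_def)
  also have "\<dots> = (\<Sum>a\<in>out_arcs G v. measure ?M (space ?M - removed {a, arev a}))"
    using sets_removed[OF assms(1)] by (subst Bochner_Integration.integral_sum)
      (auto intro!: integrable_real_indicator simp: emeasure_eq_measure)
  also have "\<dots> = (\<Sum>a\<in>out_arcs G v. 1 - measure ?M (removed {a, arev a}))"
    using sets_removed[OF assms(1)] by (simp add: prob_compl)
  finally show ?thesis .
qed

text \<open>Put \<open>t = 1 / (2 * R)\<close>. An edge with label at most \<open>t\<close> can only be removed because of a cycle all
  of whose labels are at most \<open>t\<close>; the expected number of closed walks at \<open>v\<close> with distinct edges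
  and such labels is at most the sum of \<open>R ^ n * t ^ n\<close> over \<open>n \<ge> 1\<close>, which is \<open>1\<close>.\<close>

lemma expected_degree_ge:
  assumes "countable (arcs G)" "finite (out_arcs G v)" "1 \<le> R"
    and fin: "\<And>n. finite {p. awalk v p v \<and> length p = n}"
    and walks: "\<And>n. real (card {p. awalk v p v \<and> length p = n}) \<le> R ^ n"
  shows "real (card (out_arcs G v)) / (2 * R) - 1 \<le> expected_degree G arev v"
proof -
  let ?M = "label_space G arev"
  interpret prob_space ?M
    by (rule prob_space_labels)
  define t where "t = 1 / (2 * R)"
  have t: "0 \<le> t" "t \<le> 1" "R * t = 1 / 2"
    using assms(3) by (auto simp: t_def)
  \<comment> \<open>Sorting by the first arc makes these sets disjoint for different
    \<open>a\<close>, so summing over \<open>a\<close> counts every closed walk at most once. The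
    index is shifted because the empty walk has no first arc.\<close>
  define Q where "Q a n = {p. awalk v p v \<and> length p = Suc n \<and> hd p = a \<and>
    card (cycle_edges arev p) = Suc n}" for a n
  have finQ: "finite (Q a n)" for a n
    by (rule finite_subset[OF _ fin[of "Suc n"]]) (auto simp: Q_def)
  \<comment> \<open>The union bound for the event that some walk in \<open>Q a n\<close> has only
    labels at most \<open>t\<close>; each walk contributes \<open>t ^ Suc n\<close> because its
    edges are distinct.\<close>
  define u where "u a n = real (card (Q a n)) * t ^ Suc n" for a n
  have sum_u: "(\<Sum>a\<in>out_arcs G v. u a n) \<le> (1 / 2) ^ Suc n" for n
  proof -
    have "(\<Sum>a\<in>out_arcs G v. card (Q a n)) = card (\<Union>a\<in>out_arcs G v. Q a n)"
      using assms(2) finQ by (intro card_UN_disjoint[symmetric]) (auto simp: Q_def)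
    also have "\<dots> \<le> card {p. awalk v p v \<and> length p = Suc n}"
      by (rule card_mono[OF fin]) (auto simp: Q_def)
    finally have "real (\<Sum>a\<in>out_arcs G v. card (Q a n)) \<le> R ^ Suc n"
      using walks[of "Suc n"] by linarith
    then have "(\<Sum>a\<in>out_arcs G v. u a n) \<le> R ^ Suc n * t ^ Suc n"
      unfolding u_def sum_distrib_right[symmetric] using t(1) by (intro mult_right_mono) auto
    also have "\<dots> = (1 / 2) ^ Suc n"
      unfolding power_mult_distrib[symmetric] t(3) ..
    finally show ?thesis .
  qed
  have u_nonneg: "0 \<le> u a n" for a n
    using t(1) by (simp add: u_def)
  have u_le: "u a n \<le> (1 / 2) ^ Suc n" if "a \<in> out_arcs G v" for a n
    using member_le_sum[OF that, of "\<lambda>a. u a n"] u_nonneg assms(2) sum_u[of n] by fastforce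
  have summable_u: "summable (u a)" if "a \<in> out_arcs G v" for a
    using sums_summable[OF power_half_series] u_le[OF that] u_nonneg
    by (intro summable_comparison_test[of "u a"]) (auto simp del: power_Suc)
  have prob_removed: "t \<le> 1 - prob (removed {a, arev a}) + suminf (u a)"
    if a: "a \<in> out_arcs G v" for a
  proof -
    let ?e = "{a, arev a}"
    let ?low = "\<lambda>J. {x \<in> space ?M. \<forall>f\<in>J. x f \<le> t}"
    let ?B = "\<lambda>n. \<Union>p\<in>Q a n. ?low (cycle_edges arev p)"
    have e: "{?e} \<subseteq> edges G arev"
      using a by (auto simp: edges_def)
    have Q_edges: "cycle_edges arev p \<subseteq> edges G arev" if "p \<in> Q a n" for p n
      using that by (intro cycle_edges_subset) (auto simp: Q_def awalk_def)
    have low_sets: "?low (cycle_edges arev p) \<in> sets ?M" if "p \<in> Q a n" for p n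
      using Q_edges[OF that] by (intro sets_labels_le finite_cycle_edges)
    have B_sets: "?B n \<in> sets ?M" for n
      using finQ low_sets by (intro sets.finite_UN) auto
    have prob_B: "prob (?B n) \<le> u a n" for n
    proof -
      have "prob (?B n) \<le> (\<Sum>p\<in>Q a n. prob (?low (cycle_edges arev p)))"
        using finQ low_sets by (intro finite_measure_subadditive_finite) auto
      also have "\<dots> = (\<Sum>p\<in>Q a n. t ^ Suc n)"
        using Q_edges t by (intro sum.cong refl, subst measure_labels_le[OF finite_cycle_edges])
          (auto simp: Q_def)
      also have "\<dots> = u a n"
        by (simp add: u_def)
      finally show ?thesis .
    qed
    have summable_B: "summable (\<lambda>n. prob (?B n))"
      using prob_B by (intro summable_comparison_test[OF _ summable_u[OF a]]) auto
    have "t = prob (?low {?e})"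
      using measure_labels_le[of "{?e}", OF _ e] t by simp
    also have "\<dots> \<le> prob ((space ?M - removed ?e) \<union> (\<Union>n. ?B n))"
    proof (rule finite_measure_mono)
      show "?low {?e} \<subseteq> (space ?M - removed ?e) \<union> (\<Union>n. ?B n)"
      proof
        fix x assume x: "x \<in> ?low {?e}"
        show "x \<in> (space ?M - removed ?e) \<union> (\<Union>n. ?B n)"
        proof (cases "x \<in> removed ?e")
          case True
          then obtain p where p: "simple_cycle G arev p" "?e \<in> cycle_edges arev p"
              "\<And>f. f \<in> cycle_edges arev p \<Longrightarrow> x f \<le> x ?e"
            unfolding removed_def by blast
          obtain q where q: "awalk (tail G a) q (tail G a)" "q \<noteq> []" "hd q = a"
              "length q = length p" "cycle_edges arev q = cycle_edges arev p"
            using simple_cycle_through_arc[OF p(1,2)] by blast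
          have "Suc (length q - 1) = length q"
            using q(2) by simp
          then have "q \<in> Q a (length q - 1)"
            unfolding Q_def using q a card_cycle_edges[OF p(1)] by simp
          moreover have "x \<in> ?low (cycle_edges arev q)"
            using x p(3) unfolding q(5) by (auto intro: order_trans)
          ultimately show ?thesis
            by blast
        qed (use x in auto)
      qed
      show "(space ?M - removed ?e) \<union> (\<Union>n. ?B n) \<in> events"
        using B_sets sets_removed[OF assms(1)] by auto
    qed
    also have "\<dots> \<le> prob (space ?M - removed ?e) + prob (\<Union>n. ?B n)"
      using B_sets sets_removed[OF assms(1)] by (intro measure_Un_le) auto
    also have "prob (\<Union>n. ?B n) \<le> suminf (\<lambda>n. prob (?B n))"
      using B_sets summable_B by (intro finite_measure_subadditive_countably) auto
    also have "suminf (\<lambda>n. prob (?B n)) \<le> suminf (u a)"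
      using prob_B summable_B summable_u[OF a] by (intro suminf_le) auto
    finally show ?thesis
      using sets_removed[OF assms(1)] by (simp add: prob_compl)
  qed
  have "real (card (out_arcs G v)) * t =
      (\<Sum>a\<in>out_arcs G v. t)"
    by simp
  also have "\<dots> \<le> (\<Sum>a\<in>out_arcs G v. 1 - prob (removed {a, arev a}) + suminf (u a))"
    by (intro sum_mono prob_removed)
  also have "\<dots> = expected_degree G arev v + (\<Sum>a\<in>out_arcs G v. suminf (u a))"
    by (simp add: sum.distrib expected_degree_eq[OF assms(1,2)])
  \<comment> \<open>Summing over the arcs first allows the use of the bound on all closed walks of a
    given length. Bounding each \<open>suminf (u a)\<close> separately by \<open>1\<close> would
    lose a factor equal to the degree.\<close>
  also have "(\<Sum>a\<in>out_arcs G v. suminf (u a)) = suminf (\<lambda>n. \<Sum>a\<in>out_arcs G v. u a n)"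
    by (rule suminf_sum[symmetric]) (rule summable_u)
  also have "\<dots> \<le> suminf (\<lambda>n. (1 / 2) ^ Suc n)"
    by (intro suminf_le sum_u summable_sum summable_u sums_summable[OF power_half_series])
  also have "\<dots> = 1"
    by (rule sums_unique[OF power_half_series, symmetric])
  finally show ?thesis
    by (simp add: t_def)
qed

end

section \<open>Cayley graphs\<close>

context group
begin

text \<open>Evaluation maps the countable set of words over a finite alphabet onto the group.
  Symmetry of the alphabet makes the inverses of letters letters themselves.\<close>

lemma countable_carrier:
  assumes "finitely_generated G"
  shows "countable (carrier G)"
proof -
  obtain A where A: "finite A" "A \<subseteq> carrier G" "m_inv G ` A = A" "generate G A = carrier G"
    using finite_symmetric_generators[OF assms] .
  let ?eval = "\<lambda>w. foldr (\<otimes>) w \<one>"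
  have closed: "?eval w \<in> carrier G" if "w \<in> lists A" for w
    using that A(2) by (induction w) auto
  have append: "?eval (v @ w) = ?eval v \<otimes> ?eval w" if "v \<in> lists A" "w \<in> lists A" for v w
    using that
  proof (induction v)
    case (Cons a v)
    then show ?case
      using closed[of v] closed[of w] A(2) by (auto simp: m_assoc subset_iff)
  qed (use closed in simp)
  have single: "a \<in> ?eval ` lists A" if "a \<in> A" for a
    using that A(2) by (intro image_eqI[of _ _ "[a]"]) auto
  have "g \<in> ?eval ` lists A" if "g \<in> generate G A" for g
    using that
  proof (induction rule: generate.induct)
    case one
    show ?case by (rule image_eqI[of _ _ "[]"]) auto
  next
    case (incl h)
    then show ?case by (rule single)
  next
    case (inv h)
    then show ?case
      using A(3) by (intro single) blast
  next
    case (eng h1 h2)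
    then obtain v w where "v \<in> lists A" "w \<in> lists A" "h1 = ?eval v" "h2 = ?eval w"
      by blast
    then show ?case
      using append[of v w] by (intro image_eqI[of _ _ "v @ w"]) auto
  qed
  then have "carrier G \<subseteq> ?eval ` lists A"
    unfolding A(4) by blast
  then show ?thesis
    by (rule countable_subset) (intro countable_image countable_lists countable_finite A(1))
qed

text \<open>Decomposition at the first step: a nonempty walk from \<open>g\<close> begins with an
  arc to some \<open>zs ! i \<otimes> g\<close>, and summing over \<open>i\<close> is one
  application of \<open>walk_op\<close>. The start therefore varies in the induction while the end
  stays \<open>\<one>\<close>.\<close>

lemma cayley_walks:
  assumes sym: "symmetric_multiset G {..<length zs} ((!) zs) \<iota>" and "g \<in> carrier G"
  shows "finite {p. pre_digraph.awalk (cayley G {..<length zs} ((!) zs)) g p \<one> \<and> length p = n} \<and>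
    real (card {p. pre_digraph.awalk (cayley G {..<length zs} ((!) zs)) g p \<one> \<and> length p = n}) \<le>
      (walk_op zs ^^ n) point_mass g"
  using assms(2)
proof (induction n arbitrary: g)
  let ?\<Gamma> = "cayley G {..<length zs} ((!) zs)"
  interpret bidirected_digraph ?\<Gamma> "cayley_rev G {..<length zs} ((!) zs) \<iota>"
    using bidirected_cayley[OF is_group sym] .
  have verts: "verts ?\<Gamma> = carrier G"
    by (simp add: cayley_def)
  {
    case 0
    have "{p. awalk g p \<one> \<and> length p = 0} = (if g = \<one> then {[]} else {})"
      using 0 verts by (auto simp: awalk_Nil_iff)
    then show ?case
      by simp
  next
    case (Suc n)
    let ?W = "\<lambda>n g. {p. awalk g p \<one> \<and> length p = n}"
    have step: "zs ! i \<otimes> g \<in> carrier G" if "i < length zs" for i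
      using sym Suc.prems that by (auto simp: symmetric_multiset_def Pi_iff)
    have eq: "?W (Suc n) g = (\<Union>i<length zs. Cons (g, i, zs ! i \<otimes> g) ` ?W n (zs ! i \<otimes> g))"
    proof (intro Set.set_eqI iffI)
      fix p assume "p \<in> ?W (Suc n) g"
      then obtain a q where aq: "p = a # q" "awalk g (a # q) \<one>" "length q = n"
        by (auto simp: length_Suc_conv)
      then have "a \<in> arcs ?\<Gamma>" "g = tail ?\<Gamma> a" "awalk (head ?\<Gamma> a) q \<one>"
        by (simp_all only: awalk_Cons_iff)
      then obtain i where "i < length zs" "a = (g, i, zs ! i \<otimes> g)" "awalk (zs ! i \<otimes> g) q \<one>"
        by (auto simp: cayley_def)
      then show "p \<in> (\<Union>i<length zs. Cons (g, i, zs ! i \<otimes> g) ` ?W n (zs ! i \<otimes> g))"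
        using aq by blast
    next
      fix p assume "p \<in> (\<Union>i<length zs. Cons (g, i, zs ! i \<otimes> g) ` ?W n (zs ! i \<otimes> g))"
      then obtain i q where i: "i < length zs" "p = (g, i, zs ! i \<otimes> g) # q"
          "awalk (zs ! i \<otimes> g) q \<one>" "length q = n"
        by blast
      then have "awalk g p \<one>"
        using Suc.prems by (simp add: awalk_Cons_iff) (simp add: cayley_def)
      then show "p \<in> ?W (Suc n) g"
        using i by simp
    qed
    have "finite (?W (Suc n) g)"
      unfolding eq using Suc.IH[OF step] by (intro finite_UN_I finite_imageI) auto
    moreover have "real (card (?W (Suc n) g)) \<le> (walk_op zs ^^ Suc n) point_mass g"
    proof -
      have "card (?W (Suc n) g) \<le> (\<Sum>i<length zs. card (Cons (g, i, zs ! i \<otimes> g) ` ?W n (zs ! i \<otimes> g)))"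
        unfolding eq by (rule card_UN_le) simp
      also have "\<dots> = (\<Sum>i<length zs. card (?W n (zs ! i \<otimes> g)))"
        by (intro sum.cong refl card_image) simp
      finally have "real (card (?W (Suc n) g)) \<le> (\<Sum>i<length zs. real (card (?W n (zs ! i \<otimes> g))))"
        unfolding of_nat_sum[symmetric] of_nat_le_iff .
      also have "\<dots> \<le> (\<Sum>i<length zs. (walk_op zs ^^ n) point_mass (zs ! i \<otimes> g))"
        using Suc.IH[OF step] by (intro sum_mono) auto
      also have "\<dots> = walk_op zs ((walk_op zs ^^ n) point_mass) g"
        unfolding walk_op_def by (simp add: sum_list_sum_nth atLeast0LessThan)
      finally show ?thesis
        by simp
    qed
    ultimately show ?case
      by blast
  }
qed

lemma delta_FMSF_ge:
  assumes "countable (carrier G)" and sym: "symmetric_multiset G {..<length zs} ((!) zs) \<iota>"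
    and R: "norm_bound zs R" "1 \<le> R"
  shows "real (length zs) / (2 * R) - 1 \<le> delta_FMSF G {..<length zs} ((!) zs) \<iota>"
proof -
  let ?\<Gamma> = "cayley G {..<length zs} ((!) zs)"
  interpret bidirected_digraph ?\<Gamma> "cayley_rev G {..<length zs} ((!) zs) \<iota>"
    using bidirected_cayley[OF is_group sym] .
  have zs: "set zs \<subseteq> carrier G"
    using sym by (auto simp: symmetric_multiset_def Pi_iff in_set_conv_nth)
  have "arcs ?\<Gamma> = (\<lambda>(g, i). (g, i, zs ! i \<otimes> g)) ` (carrier G \<times> {..<length zs})"
    by (auto simp: cayley_def)
  then have count: "countable (arcs ?\<Gamma>)"
    using assms(1) by simp
  have out: "out_arcs ?\<Gamma> \<one> = (\<lambda>i. (\<one>, i, zs ! i \<otimes> \<one>)) ` {..<length zs}"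
    by (auto simp: out_arcs_def cayley_def)
  \<comment> \<open>The elements of the multi-set are positions in the list, so equal entries give
    different parallel arcs.\<close>
  have "card (out_arcs ?\<Gamma> \<one>) = length zs"
    unfolding out by (subst card_image) (auto intro: inj_onI)
  moreover have "finite (out_arcs ?\<Gamma> \<one>)"
    unfolding out by simp
  moreover have "real (card {p. awalk \<one> p \<one> \<and> length p = n}) \<le> R ^ n" for n
    using cayley_walks[OF sym one_closed, of n] walk_op_power_le[OF R(1) zs, of n] R(2) by linarith
  ultimately show ?thesis
    unfolding delta_FMSF_def
    using expected_degree_ge[OF count _ R(2), of \<one>] cayley_walks[OF sym one_closed] by metis
qed

text \<open>Exchanging the two halves of the list is an involution without fixed points on the
  positions, so entries equal to the identity satisfy the last condition of
  \<open>symmetric_multiset\<close> too.\<close>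

lemma symmetric_multiset_append_inv:
  assumes "set xs \<subseteq> carrier G"
  shows "symmetric_multiset G {..<length (xs @ map (m_inv G) xs)} ((!) (xs @ map (m_inv G) xs))
    (\<lambda>i. if i < length xs then i + length xs else i - length xs)"
proof -
  have "xs ! i \<in> carrier G" if "i < length xs" for i
    using assms that nth_mem by blast
  then show ?thesis
    unfolding symmetric_multiset_def by (auto simp: nth_append split: if_splits)
qed

lemma generating_multiset_delta_FMSF_ge:
  assumes "finitely_generated G" "\<not> amenable G"
  shows "\<exists>(S :: nat set) \<alpha> \<iota>. generating_multiset G S \<alpha> \<iota> \<and> real n \<le> delta_FMSF G S \<alpha> \<iota>"
proof -
  \<comment> \<open>The doubled list has length at least \<open>4 * (n + 1) * R\<close> and norm
    bound \<open>2 * R\<close>. The general lower bound divides by twice the norm bound and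
    subtracts \<open>1\<close>, which leaves \<open>n\<close>.\<close>
  obtain xs R where xs: "set xs \<subseteq> carrier G" "generate G (set xs) = carrier G" and R: "1 \<le> R"
      "norm_bound (xs @ map (m_inv G) xs) (2 * R)" "2 * (real n + 1) * R \<le> real (length xs)"
    using nonamenable_large_ratio[OF assms, of "2 * (real n + 1)"] by blast
  define zs where "zs = xs @ map (m_inv G) xs"
  define \<iota> where "\<iota> = (\<lambda>i. if i < length xs then i + length xs else i - length xs)"
  have sym: "symmetric_multiset G {..<length zs} ((!) zs) \<iota>"
    unfolding zs_def \<iota>_def by (rule symmetric_multiset_append_inv[OF xs(1)])
  have "(!) zs ` {..<length zs} = set zs"
    by (auto simp: set_conv_nth)
  moreover have "generate G (set zs) = carrier G"
  proof -
    have "set zs \<subseteq> carrier G" "set xs \<subseteq> set zs"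
      using xs(1) by (auto simp: zs_def)
    then show ?thesis
      using generate_incl mono_generate xs(2) by blast
  qed
  ultimately have "generating_multiset G {..<length zs} ((!) zs) \<iota>"
    using sym by (simp add: generating_multiset_def)
  moreover have "real n \<le> delta_FMSF G {..<length zs} ((!) zs) \<iota>"
  proof -
    have "real n + 1 \<le> real (length zs) / (2 * (2 * R))"
      using R by (simp add: zs_def le_divide_eq mult_ac)
    also have "\<dots> \<le> delta_FMSF G {..<length zs} ((!) zs) \<iota> + 1"
      using delta_FMSF_ge[OF countable_carrier[OF assms(1)] sym R(2)[folded zs_def]] R(1) by simp
    finally show ?thesis
      by simp
  qed
  ultimately show ?thesis
    by blast
qed

end

theorem corollary2:
  fixes \<Gamma> :: "('a, 'm) monoid_scheme"
  assumes "group \<Gamma>"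
    and "finitely_generated \<Gamma>"
    and "\<not> amenable \<Gamma>"
  shows "(\<exists>(S :: nat set) \<alpha> \<iota> (S' :: nat set) \<alpha>' \<iota>'.
            generating_multiset \<Gamma> S \<alpha> \<iota> \<and> generating_multiset \<Gamma> S' \<alpha>' \<iota>' \<and>
            delta_FMSF \<Gamma> S \<alpha> \<iota> \<noteq> delta_FMSF \<Gamma> S' \<alpha>' \<iota>') \<and>
         (\<forall>n :: nat. \<exists>(S :: nat set) \<alpha> \<iota>.
            generating_multiset \<Gamma> S \<alpha> \<iota> \<and> delta_FMSF \<Gamma> S \<alpha> \<iota> \<ge> real n)"
proof
  interpret group \<Gamma> by fact
  note large = generating_multiset_delta_FMSF_ge[OF assms(2,3)]
  show "\<forall>n :: nat. \<exists>(S :: nat set) \<alpha> \<iota>.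
      generating_multiset \<Gamma> S \<alpha> \<iota> \<and> delta_FMSF \<Gamma> S \<alpha> \<iota> \<ge> real n"
    using large by blast
  obtain S :: "nat set" and \<alpha> \<iota> where S: "generating_multiset \<Gamma> S \<alpha> \<iota>"
    using large by blast
  \<comment> \<open>The attained values are unbounded, so some multi-set exceeds the value of
    \<open>S\<close>.\<close>
  obtain n where n: "delta_FMSF \<Gamma> S \<alpha> \<iota> < real n"
    using reals_Archimedean2 by blast
  obtain S' :: "nat set" and \<alpha>' \<iota>' where
    S': "generating_multiset \<Gamma> S' \<alpha>' \<iota>'" "real n \<le> delta_FMSF \<Gamma> S' \<alpha>' \<iota>'"
    using large by blast
  then have "delta_FMSF \<Gamma> S \<alpha> \<iota> \<noteq> delta_FMSF \<Gamma> S' \<alpha>' \<iota>'"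
    using n by linarith
  then show "\<exists>(S :: nat set) \<alpha> \<iota> (S' :: nat set) \<alpha>' \<iota>'.
      generating_multiset \<Gamma> S \<alpha> \<iota> \<and> generating_multiset \<Gamma> S' \<alpha>' \<iota>' \<and>
      delta_FMSF \<Gamma> S \<alpha> \<iota> \<noteq> delta_FMSF \<Gamma> S' \<alpha>' \<iota>'"
    using S S'(1) by blast
qed

end
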